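(* For every $k\in\mathbb{Z}^+$ there exists an integer $n_k$ such that for all $n\ge n_k$ we have $\operatorname{gon}(H_{2k,n})=\operatorname{gon}(H_{2k,n_k})$.
   Context: For integers $k\ge 1$ and $n\ge 2k+1$, the Harary graph $H_{2k,n}$ is the circulant graph on vertices $v_1,\ldots,v_n$ in which $v_i$ is adjacent to $v_m$ if and only if $|i-m|\bmod n\in\{1,2,\ldots,k\}$. For a connected loopless multigraph $G$: a divisor is a function $D:V(G)\to\mathbb{Z}$; it is effective if $D(v)\ge0$ for all $v$; its degree is $\sum_v D(v)$. Firing a vertex $v$ moves one chip from $v$ along each edge incident to $v$; two divisors are equivalent if related by a sequence of firings. $D$ has positive rank if for every vertex $q$, $D-q$ is equivalent to an effective divisor. The gonality $\operatorname{gon}(G)$ is the minimum degree of a positive rank divisor on $G$. *)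

theory Defs
  imports Main
begin

text \<open>
  A multigraph is given by its vertex set together with the number
  \<open>mult G u v\<close> of edges joining \<open>u\<close> and \<open>v\<close>.
\<close>

record 'v multigraph =
  verts :: "'v set"
  mult :: "'v \<Rightarrow> 'v \<Rightarrow> nat"

definition adjacency :: "'v multigraph \<Rightarrow> ('v \<times> 'v) set" where
  "adjacency G = {(u, v). u \<in> verts G \<and> v \<in> verts G \<and> mult G u v > 0}"

locale connected_multigraph =
  fixes G :: "'v multigraph"
  assumes finite_verts: "finite (verts G)"
    and verts_nonempty: "verts G \<noteq> {}"
    and mult_outside: "u \<notin> verts G \<or> v \<notin> verts G \<Longrightarrow> mult G u v = 0"
    and mult_sym: "mult G u v = mult G v u"
    and loopless: "mult G v v = 0"
    and connected: "u \<in> verts G \<Longrightarrow> v \<in> verts G \<Longrightarrow> (u, v) \<in> (adjacency G)\<^sup>*"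

text \<open>
  Divisors are integer functions on the vertex set, extended by \<open>0\<close> to the whole type so that
  equality of divisors is equality of functions.
\<close>

definition divisors :: "'v multigraph \<Rightarrow> ('v \<Rightarrow> int) set" where
  "divisors G = {D. \<forall>v. v \<notin> verts G \<longrightarrow> D v = 0}"

definition degree :: "'v multigraph \<Rightarrow> ('v \<Rightarrow> int) \<Rightarrow> int" where
  "degree G D = (\<Sum>v\<in>verts G. D v)"

definition effective :: "'v multigraph \<Rightarrow> ('v \<Rightarrow> int) \<Rightarrow> bool" where
  "effective G D \<longleftrightarrow> (\<forall>v\<in>verts G. D v \<ge> 0)"

definition fire :: "'v multigraph \<Rightarrow> 'v \<Rightarrow> ('v \<Rightarrow> int) \<Rightarrow> ('v \<Rightarrow> int)" where
  "fire G v D = (\<lambda>w. if w = v then D v - (\<Sum>u\<in>verts G. int (mult G v u))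
                      else D w + int (mult G v w))"

text \<open>
  No inverse moves are included: in a finite multigraph, firing every vertex once changes
  nothing, so firing all vertices but \<open>v\<close> undoes firing \<open>v\<close>. Symmetry is shown below.
\<close>

definition equivalent :: "'v multigraph \<Rightarrow> ('v \<Rightarrow> int) \<Rightarrow> ('v \<Rightarrow> int) \<Rightarrow> bool" where
  "equivalent G = (\<lambda>D D'. \<exists>v\<in>verts G. D' = fire G v D)\<^sup>*\<^sup>*"

definition positive_rank :: "'v multigraph \<Rightarrow> ('v \<Rightarrow> int) \<Rightarrow> bool" where
  "positive_rank G D \<longleftrightarrow>
     (\<forall>q\<in>verts G. \<exists>E\<in>divisors G. effective G E \<and> equivalent G (D(q := D q - 1)) E)"

text \<open>
  The minimum may be taken over the natural numbers: by \<open>degree_positive_rank\<close> below,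
  divisors of positive rank have positive degree. It is attained by \<open>gonality_attained\<close>.
\<close>

definition gonality :: "'v multigraph \<Rightarrow> nat" where
  "gonality G = (LEAST d. \<exists>D\<in>divisors G. positive_rank G D \<and> degree G D = int d)"

text \<open>
  \<open>harary k n\<close> is the graph \<open>H\<^bsub>2k,n\<^esub>\<close>, on the vertices \<open>1, \<dots>, n\<close>. Adjacency
  depends on the cyclic distance of the indices, so both residues \<open>i - j\<close> and \<open>j - i\<close>
  modulo \<open>n\<close> are considered (the ordinary absolute value \<open>\<bar>i - j\<bar> < n\<close>
  would lose the edges wrapping around from \<open>n\<close> to \<open>1\<close>).
\<close>

definition harary :: "nat \<Rightarrow> nat \<Rightarrow> nat multigraph" where
  "harary k n =
     \<lparr>verts = {1..n},
      mult = (\<lambda>i j. if i \<in> {1..n} \<and> j \<in> {1..n} \<and>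
                        ((int i - int j) mod int n \<in> {1..int k} \<or>
                         (int j - int i) mod int n \<in> {1..int k})
                     then 1 else 0)\<rparr>"

lemma connected_multigraph_harary:
  assumes "k \<ge> 1" and "n \<ge> 2 * k + 1"
  shows "connected_multigraph (harary k n)"
proof
  let ?R = "adjacency (harary k n)"
  have edge: "(i, Suc i) \<in> ?R \<and> (Suc i, i) \<in> ?R" if "1 \<le> i" "i < n" for i
  proof -
    have "(int (Suc i) - int i) mod int n = 1"
      using assms by simp
    then show ?thesis
      using assms that unfolding adjacency_def harary_def by simp
  qed
  have path: "(1, i) \<in> ?R\<^sup>* \<and> (i, 1) \<in> ?R\<^sup>*" if "1 \<le> i" "i \<le> n" for i
    using that
  proof (induction i rule: dec_induct)
    case (step i)
    then have "(1, i) \<in> ?R\<^sup>*" "(i, 1) \<in> ?R\<^sup>*" "(i, Suc i) \<in> ?R" "(Suc i, i) \<in> ?R"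
      using edge[of i] by simp_all
    then show ?case
      by (blast intro: rtrancl_into_rtrancl converse_rtrancl_into_rtrancl)
  qed simp
  fix u v
  show "(u, v) \<in> ?R\<^sup>*" if "u \<in> verts (harary k n)" "v \<in> verts (harary k n)"
  proof -
    have "(u, 1) \<in> ?R\<^sup>*" "(1, v) \<in> ?R\<^sup>*"
      using path[of u] path[of v] that by (simp_all add: harary_def)
    then show ?thesis by (rule rtrancl_trans)
  qed
  show "finite (verts (harary k n))" "verts (harary k n) \<noteq> {}"
    using assms by (simp_all add: harary_def)
  show "mult (harary k n) u v = 0" if "u \<notin> verts (harary k n) \<or> v \<notin> verts (harary k n)"
    using that by (auto simp: harary_def)
  show "mult (harary k n) u v = mult (harary k n) v u"
    unfolding harary_def by (simp add: conj_ac disj_commute)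
  show "mult (harary k n) v v = 0"
    by (simp add: harary_def)
qed

context connected_multigraph
begin

lemma fire_in_divisors:
  assumes "v \<in> verts G" "D \<in> divisors G"
  shows "fire G v D \<in> divisors G"
  using assms by (auto simp: divisors_def fire_def mult_outside)

lemma fire_eq:
  "fire G v D = (\<lambda>w. D w + int (mult G v w) - (if w = v then \<Sum>u\<in>verts G. int (mult G v u) else 0))"
  by (auto simp: fire_def loopless)

lemma degree_fire:
  assumes "v \<in> verts G"
  shows "degree G (fire G v D) = degree G D"
  using assms finite_verts
  by (simp add: degree_def fire_eq sum.distrib sum_subtractf)

lemma degree_equivalent: "equivalent G D E \<Longrightarrow> degree G D = degree G E"
  unfolding equivalent_def by (induction rule: rtranclp_induct) (auto simp: degree_fire)

lemma equivalent_fire_set: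
  assumes "finite A" "A \<subseteq> verts G"
  shows "equivalent G D (\<lambda>w. D w + (\<Sum>v\<in>A. int (mult G v w))
           - (if w \<in> A then \<Sum>u\<in>verts G. int (mult G w u) else 0))"
  using assms
proof (induction A rule: finite_induct)
  case empty
  then show ?case by (simp add: equivalent_def)
next
  case (insert x A)
  let ?E = "\<lambda>A w. D w + (\<Sum>v\<in>A. int (mult G v w))
           - (if w \<in> A then \<Sum>u\<in>verts G. int (mult G w u) else 0)"
  have "?E (insert x A) = fire G x (?E A)"
    using insert.hyps by (simp add: fire_eq fun_eq_iff)
  moreover have "equivalent G D (?E A)" "x \<in> verts G"
    using insert by auto
  ultimately show ?case
    unfolding equivalent_def by (auto intro: rtranclp.rtrancl_into_rtrancl)
qed

lemma equivalent_fire_back: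
  assumes "v \<in> verts G"
  shows "equivalent G (fire G v D) D"
proof -
  let ?A = "verts G - {v}"
  have "(\<lambda>w. fire G v D w + (\<Sum>x\<in>?A. int (mult G x w))
           - (if w \<in> ?A then \<Sum>u\<in>verts G. int (mult G w u) else 0)) = D"
  proof
    fix w
    have "(\<Sum>x\<in>?A. int (mult G x w)) = (\<Sum>u\<in>verts G. int (mult G w u)) - int (mult G v w)"
      using assms finite_verts by (simp add: sum_diff1 mult_sym[of w])
    then show "fire G v D w + (\<Sum>x\<in>?A. int (mult G x w))
           - (if w \<in> ?A then \<Sum>u\<in>verts G. int (mult G w u) else 0) = D w"
      using assms by (auto simp: fire_eq mult_outside)
  qed
  then show ?thesis
    using equivalent_fire_set[of ?A "fire G v D"] finite_verts by auto
qed

lemma equivalent_sym: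
  assumes "equivalent G D E"
  shows "equivalent G E D"
  using assms unfolding equivalent_def
proof (induction rule: rtranclp_induct)
  case (step E F)
  then obtain v where "v \<in> verts G" "F = fire G v E" by auto
  then have "(\<lambda>D D'. \<exists>v\<in>verts G. D' = fire G v D)\<^sup>*\<^sup>* F E"
    using equivalent_fire_back unfolding equivalent_def by auto
  with step.IH show ?case by (rule rtranclp_trans[rotated])
qed simp

lemma degree_positive_rank:
  assumes "positive_rank G D"
  shows "degree G D \<ge> 1"
proof -
  obtain q where q: "q \<in> verts G" using verts_nonempty by auto
  then obtain E where "effective G E" "equivalent G (D(q := D q - 1)) E"
    using assms by (auto simp: positive_rank_def)
  then have "degree G (D(q := D q - 1)) = degree G E"
    by (intro degree_equivalent)
  moreover have "0 \<le> degree G E"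
    using \<open>effective G E\<close> by (simp add: degree_def effective_def sum_nonneg)
  moreover have "D(q := D q - 1) = (\<lambda>v. D v - (if v = q then 1 else 0))"
    by auto
  ultimately show ?thesis
    using q finite_verts by (simp add: degree_def sum_subtractf)
qed

lemma gonality_attained:
  "\<exists>D\<in>divisors G. positive_rank G D \<and> degree G D = int (gonality G)"
proof -
  let ?D = "\<lambda>v. if v \<in> verts G then 1 else 0 :: int"
  have "positive_rank G ?D"
    unfolding positive_rank_def
  proof
    fix q assume "q \<in> verts G"
    then show "\<exists>E\<in>divisors G. effective G E \<and> equivalent G (?D(q := ?D q - 1)) E"
      by (intro bexI[of _ "?D(q := ?D q - 1)"])
        (auto simp: effective_def equivalent_def divisors_def)
  qed
  moreover have "?D \<in> divisors G" "degree G ?D = int (card (verts G))"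
    by (auto simp: divisors_def degree_def)
  ultimately have "\<exists>d. \<exists>D\<in>divisors G. positive_rank G D \<and> degree G D = int d" by blast
  then show ?thesis unfolding gonality_def by (rule LeastI_ex)
qed

end

end

theory Submission
  imports Defs
begin

text \<open>
  In fact the gonality of \<open>H\<^bsub>2k,n\<^esub>\<close> is \<open>2\<sigma>\<close> for all large \<open>n\<close>, where
  \<open>\<sigma> = 1\<^sup>2 + \<dots> + k\<^sup>2\<close>. Divisors and firing scripts are unrolled to \<open>n\<close>-periodic functions on
  the integers, with Laplacian \<open>lap\<close>.

  Upper bound: the divisor \<open>R\<^sub>c\<close> of degree \<open>\<sigma>\<close> created by a slope change at \<open>c\<close> satisfies
  \<open>R\<^sub>c\<^sub>+\<^sub>1 + R\<^sub>c\<^sub>-\<^sub>1 \<sim> 2 R\<^sub>c\<close> by firing \<open>c\<close> once. So \<open>2 R\<^sub>0 \<sim> R\<^sub>r + R\<^sub>-\<^sub>r\<close> for every \<open>r\<close>, and \<open>R\<^sub>r\<close> has a chip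
  on \<open>r\<close>.

  Lower bound: let \<open>D\<close> be effective of positive rank and degree less than \<open>2\<sigma>\<close>. It has a very long
  gap; a script \<open>\<phi>\<close> bringing a chip to the middle \<open>q\<close> of this gap ends in an effective divisor \<open>E\<close>. On
  long intervals free of chips of \<open>D\<close> and \<open>E\<close>, \<open>\<phi>\<close> is integral, harmonic and of bounded slope, hence
  affine, and carries a flow of \<open>\<sigma>\<close> times its slope. The flow changes at \<open>q\<close>, so on a long interval
  next to \<open>q\<close> the slope is nonzero. Around the cycle \<open>\<phi>\<close> must return to its value, and since few
  places are near a chip, some level is crossed a second time in an affine stretch. The cut at that
  level carries a flow of at least \<open>2\<sigma>\<close>, which cannot exceed the degree.
\<close>

section \<open>Periodic functions and the Laplacian\<close>

definition periodic :: "int \<Rightarrow> (int \<Rightarrow> 'a) \<Rightarrow> bool" where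
  "periodic n f \<longleftrightarrow> (\<forall>x. f (x + n) = f x)"

lemma periodic_sum_step:
  fixes h :: "int \<Rightarrow> int"
  assumes "periodic n h" "n > 0"
  shows "(\<Sum>x\<in>{a + 1..<a + 1 + n}. h x) = (\<Sum>x\<in>{a..<a + n}. h x)"
proof -
  have "{a..<a + n} = insert a {a + 1..<a + n}" "{a + 1..<a + 1 + n} = insert (a + n) {a + 1..<a + n}"
    using assms by auto
  then show ?thesis using assms by (simp add: periodic_def)
qed

lemma periodic_sum_start:
  fixes h :: "int \<Rightarrow> int"
  assumes "periodic n h" "n > 0"
  shows "(\<Sum>x\<in>{a..<a + n}. h x) = (\<Sum>x\<in>{0..<n}. h x)"
proof (induction a rule: int_induct[where k = 0])
  case (step1 i)
  then show ?case using periodic_sum_step[OF assms, of i] by simp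
next
  case (step2 i)
  then show ?case using periodic_sum_step[OF assms, of "i - 1"] by simp
qed simp

lemma periodic_sum_shift:
  fixes h :: "int \<Rightarrow> int"
  assumes "periodic n h" "n > 0"
  shows "(\<Sum>x\<in>{a..<a + n}. h (x + j)) = (\<Sum>x\<in>{a..<a + n}. h x)"
proof -
  have "(\<Sum>x\<in>{a..<a + n}. h (x + j)) = (\<Sum>x\<in>{a + j..<a + j + n}. h x)"
    by (rule sum.reindex_bij_witness[of _ "\<lambda>x. x - j" "\<lambda>x. x + j"]) auto
  then show ?thesis using periodic_sum_start[OF assms] by simp
qed

text \<open>The number of chips that x loses when every y is fired \<phi> y times, the neighbours of
  x being the other integers at distance at most k.\<close>

definition lap :: "nat \<Rightarrow> (int \<Rightarrow> int) \<Rightarrow> int \<Rightarrow> int" where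
  "lap k \<phi> x = (\<Sum>j=1..k. 2 * \<phi> x - \<phi> (x + int j) - \<phi> (x - int j))"

lemma lap_add: "lap k (\<lambda>x. f x + g x) x = lap k f x + lap k g x"
  by (simp add: lap_def sum.distrib[symmetric] algebra_simps)

lemma lap_minus: "lap k (\<lambda>x. - f x) x = - lap k f x"
  by (simp add: lap_def sum_negf[symmetric] algebra_simps)

lemma lap_diff: "lap k (\<lambda>x. f x - g x) x = lap k f x - lap k g x"
  by (simp add: lap_def sum_subtractf[symmetric] algebra_simps)

lemma lap_shift: "lap k (\<lambda>x. f (x + t)) x = lap k f (x + t)"
  by (simp add: lap_def algebra_simps)

lemma periodic_lap:
  assumes "periodic n f" shows "periodic n (lap k f)"
proof -
  have "(\<lambda>x. f (x + n)) = f" using assms by (auto simp: periodic_def)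
  then show ?thesis using lap_shift[of k f n] by (simp add: periodic_def)
qed

text \<open>
  The flow along the edge from \<open>x\<close> to \<open>x + j\<close> if the superlevel set \<open>{\<phi> \<ge> c}\<close> separates its ends.
\<close>

definition cut_term :: "(int \<Rightarrow> int) \<Rightarrow> int \<Rightarrow> int \<Rightarrow> nat \<Rightarrow> int" where
  "cut_term \<phi> c x j = (of_bool (c \<le> \<phi> x) - of_bool (c \<le> \<phi> (x + int j))) * (\<phi> x - \<phi> (x + int j))"

lemma cut_term_nonneg: "0 \<le> cut_term \<phi> c x j"
  by (auto simp: cut_term_def)

text \<open>Summation by parts against the indicator of the superlevel set: shifting the backward
  differences by j over a period pairs them with the forward ones, so each edge is counted once, at
  its left end.\<close>

lemma sum_lap_superlevel:
  assumes "periodic n \<phi>" "n > 0"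
  shows "(\<Sum>x\<in>{a..<a + n}. of_bool (c \<le> \<phi> x) * lap k \<phi> x)
       = (\<Sum>x\<in>{a..<a + n}. \<Sum>j=1..k. cut_term \<phi> c x j)"
proof -
  let ?I = "{a..<a + n}" and ?u = "\<lambda>x. of_bool (c \<le> \<phi> x) :: int"
  have shift: "(\<Sum>x\<in>?I. ?u x * (\<phi> x - \<phi> (x - int j))) = (\<Sum>x\<in>?I. ?u (x + int j) * (\<phi> (x + int j) - \<phi> x))" for j
  proof -
    have "periodic n (\<lambda>x. ?u x * (\<phi> x - \<phi> (x - int j)))"
      using assms unfolding periodic_def
      by (metis (no_types, lifting) add.commute add_diff_eq)
    from periodic_sum_shift[OF this assms(2), where a = a and j = "int j"] show ?thesis
      by (simp only: add_diff_cancel)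
  qed
  have "(\<Sum>x\<in>?I. ?u x * lap k \<phi> x)
      = (\<Sum>x\<in>?I. \<Sum>j=1..k. ?u x * (\<phi> x - \<phi> (x + int j)) + ?u x * (\<phi> x - \<phi> (x - int j)))"
    by (simp add: lap_def sum_distrib_left algebra_simps)
  also have "\<dots> = (\<Sum>j=1..k. (\<Sum>x\<in>?I. ?u x * (\<phi> x - \<phi> (x + int j))) + (\<Sum>x\<in>?I. ?u x * (\<phi> x - \<phi> (x - int j))))"
    by (subst sum.swap) (simp add: sum.distrib)
  also have "\<dots> = (\<Sum>j=1..k. \<Sum>x\<in>?I. cut_term \<phi> c x j)"
    unfolding shift sum.distrib[symmetric]
    by (intro sum.cong refl) (simp add: cut_term_def algebra_simps)
  also have "\<dots> = (\<Sum>x\<in>?I. \<Sum>j=1..k. cut_term \<phi> c x j)" by (rule sum.swap)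
  finally show ?thesis .
qed

text \<open>The superlevel set can only send out chips it owns: there the Laplacian D - E is at most
  D, and elsewhere D is nonnegative.\<close>

lemma sum_cut_term_le:
  assumes per: "periodic n \<phi>" "periodic n D" and n: "n > 0"
    and D: "\<And>x. 0 \<le> D x" and E: "\<And>x. 0 \<le> E x"
    and lap: "\<And>x. lap k \<phi> x = D x - E x"
  shows "(\<Sum>x\<in>{a..<a + n}. \<Sum>j=1..k. cut_term \<phi> c x j) \<le> (\<Sum>x\<in>{0..<n}. D x)"
proof -
  have "(\<Sum>x\<in>{a..<a + n}. \<Sum>j=1..k. cut_term \<phi> c x j)
      = (\<Sum>x\<in>{a..<a + n}. of_bool (c \<le> \<phi> x) * lap k \<phi> x)"
    using sum_lap_superlevel[OF per(1) n] by simp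
  also have "\<dots> \<le> (\<Sum>x\<in>{a..<a + n}. D x)"
    using D E by (intro sum_mono) (simp add: lap)
  also have "\<dots> = (\<Sum>x\<in>{0..<n}. D x)" by (rule periodic_sum_start[OF per(2) n])
  finally show ?thesis .
qed

text \<open>If the two values differ, the level of the larger one cuts the edge from x to x + 1. The
  term of this edge is the absolute difference, and all other terms of the cut are
  nonnegative.\<close>

lemma slope_le:
  assumes per: "periodic n \<phi>" "periodic n D" and n: "n > 0"
    and D: "\<And>x. 0 \<le> D x" and E: "\<And>x. 0 \<le> E x"
    and lap: "\<And>x. lap k \<phi> x = D x - E x" and k: "k \<ge> 1"
  shows "\<bar>\<phi> (x + 1) - \<phi> x\<bar> \<le> (\<Sum>x\<in>{0..<n}. D x)"
proof -
  let ?c = "max (\<phi> x) (\<phi> (x + 1))"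
  have "\<bar>\<phi> (x + 1) - \<phi> x\<bar> = cut_term \<phi> ?c x 1"
    by (auto simp: cut_term_def max_def)
  also have "\<dots> \<le> (\<Sum>j=1..k. cut_term \<phi> ?c x j)"
    using k by (intro member_le_sum cut_term_nonneg) auto
  also have "\<dots> \<le> (\<Sum>x\<in>{x..<x + n}. \<Sum>j=1..k. cut_term \<phi> ?c x j)"
    using n by (intro member_le_sum[of x] sum_nonneg cut_term_nonneg) auto
  also have "\<dots> \<le> (\<Sum>x\<in>{0..<n}. D x)"
    by (rule sum_cut_term_le[OF per n D E lap])
  finally show ?thesis .
qed

section \<open>Rigidity of harmonic functions on intervals\<close>

lemma lap_eq_0_iff: "lap k g x = 0 \<longleftrightarrow> (\<Sum>j=1..k. g (x + int j) + g (x - int j)) = 2 * int k * g x"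
proof -
  have "lap k g x = 2 * int k * g x - (\<Sum>j=1..k. g (x + int j) + g (x - int j))"
    by (simp add: lap_def sum.distrib sum_subtractf)
  then show ?thesis by auto
qed

text \<open>Harmonicity at z - k is a linear recurrence of order 2k that determines g z from the 2k
  preceding values.\<close>

lemma harmonic_const_right:
  assumes k: "k \<ge> 1"
    and harm: "\<And>x. a \<le> x \<Longrightarrow> x \<le> b \<Longrightarrow> lap k g x = 0"
    and c: "\<And>x. y \<le> x \<Longrightarrow> x < y + 2 * int k \<Longrightarrow> g x = c" and y: "a - int k \<le> y"
    and z: "y \<le> z" "z \<le> b + int k"
  shows "g z = c"
  using z
proof (induction "nat (z - y)" arbitrary: z rule: less_induct)
  case less
  show ?case
  proof (cases "z < y + 2 * int k")
    case False
    let ?x = "z - int k"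
    have g: "g t = c" if "z - 2 * int k \<le> t" "t < z" for t
      using less False that by auto
    have "(\<Sum>j=1..k. g (?x + int j) + g (?x - int j)) = 2 * int k * g ?x"
      using harm[of ?x] less False y k by (simp add: lap_eq_0_iff)
    \<comment> \<open>Only the term j = k contains g z; every other value lies in the constant block
      already known.\<close>
    moreover have "(\<Sum>j=1..k. g (?x + int j) + g (?x - int j)) = (\<Sum>j=1..k. (if j = k then g z - c else 0) + 2 * c)"
      using k by (intro sum.cong refl) (auto simp: g)
    moreover have "\<dots> = g z - c + 2 * int k * c"
      using k by (simp add: sum.distrib)
    moreover have "g ?x = c" using k by (intro g) auto
    ultimately show ?thesis by simp
  qed (use c less in auto)
qed

lemma lap_reflect: "lap k (\<lambda>x. g (- x)) x = lap k g (- x)"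
  by (simp add: lap_def algebra_simps)

text \<open>The recurrence is symmetric under reflection, so a constant block spreads to the left as
  well.\<close>

lemma harmonic_const:
  assumes k: "k \<ge> 1"
    and harm: "\<And>x. a \<le> x \<Longrightarrow> x \<le> b \<Longrightarrow> lap k g x = 0"
    and c: "\<And>x. y \<le> x \<Longrightarrow> x < y + 2 * int k \<Longrightarrow> g x = c"
    and y: "a - int k \<le> y" "y + 2 * int k \<le> b + int k + 1"
    and z: "a - int k \<le> z" "z \<le> b + int k"
  shows "g z = c"
proof (cases "y \<le> z")
  case True
  then show ?thesis using harmonic_const_right[OF k harm c y(1) _ z(2)] by blast
next
  case False
  have "(\<lambda>x. g (- x)) (- z) = c"
  proof (rule harmonic_const_right[OF k, where g = "\<lambda>x. g (- x)" and z = "- z"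
        and a = "- b" and b = "- a" and y = "- (y + 2 * int k - 1)"])
    show "lap k (\<lambda>x. g (- x)) x = 0" if "- b \<le> x" "x \<le> - a" for x
      using harm[of "- x"] that by (simp add: lap_reflect)
  qed (use c y z False in auto)
  then show ?thesis by simp
qed

text \<open>Maximum principle: the deficits g m - g x over the neighbours x of m are nonnegative and
  sum to zero.\<close>

lemma harmonic_const_of_max:
  assumes k: "k \<ge> 1" and harm: "lap k g m = 0"
    and max: "\<And>x. m - int k \<le> x \<Longrightarrow> x \<le> m + int k \<Longrightarrow> g x \<le> g m"
    and x: "m - int k \<le> x" "x \<le> m + int k"
  shows "g x = g m"
proof -
  let ?t = "\<lambda>j. (g m - g (m + int j)) + (g m - g (m - int j))"
  have "(\<Sum>j=1..k. ?t j) = 0"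
    using harm by (simp add: lap_def algebra_simps)
  moreover have nn: "0 \<le> g m - g (m + int j)" "0 \<le> g m - g (m - int j)" if "j \<in> {1..k}" for j
    using that max[of "m + int j"] max[of "m - int j"] by auto
  moreover have "(\<Sum>j=1..k. ?t j) = 0 \<longleftrightarrow> (\<forall>j\<in>{1..k}. ?t j = 0)"
  proof (rule sum_nonneg_eq_0_iff)
    show "0 \<le> ?t j" if "j \<in> {1..k}" for j
      using nn[OF that] by linarith
  qed simp
  ultimately have "\<forall>j\<in>{1..k}. ?t j = 0" by blast
  then have t: "g (m + int j) = g m \<and> g (m - int j) = g m" if "j \<in> {1..k}" for j
    using that nn[OF that] by (smt (verit))
  show ?thesis
  proof (cases "x = m")
    case False
    then have "nat \<bar>x - m\<bar> \<in> {1..k}" using x by simp linarith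
    then show ?thesis using t[of "nat \<bar>x - m\<bar>"] by (cases "x < m") auto
  qed simp
qed

text \<open>
  By induction on the number of values: either the largest allowed value is attained inside, and the
  maximum principle gives a constant block, or the range shrinks on a slightly smaller interval.
  A constant block of length \<open>2k\<close> determines a solution of the recurrence in both directions.
\<close>

lemma bounded_harmonic_const:
  fixes lo :: int
  assumes k: "k \<ge> 1"
    and harm: "\<And>x. a \<le> x \<Longrightarrow> x \<le> b \<Longrightarrow> lap k g x = 0"
    and bd: "\<And>x. a - int k \<le> x \<Longrightarrow> x \<le> b + int k \<Longrightarrow> lo \<le> g x \<and> g x \<le> lo + int M"
    and len: "2 * int k * int M \<le> b - a"
  shows "\<exists>c. \<forall>x. a - int k \<le> x \<longrightarrow> x \<le> b + int k \<longrightarrow> g x = c"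
  using harm bd len
proof (induction M arbitrary: a b)
  case 0
  then show ?case by (intro exI[of _ lo]) force
next
  case (Suc M)
  note harm = Suc.prems(1) and bd = Suc.prems(2) and len = Suc.prems(3)
  have len': "2 * int k * int M + 2 * int k \<le> b - a" using len by (simp add: algebra_simps)
  moreover have "0 \<le> 2 * int k * int M" by simp
  ultimately have ab: "2 * int k \<le> b - a" by linarith
  have "\<exists>y c. a - int k \<le> y \<and> y + 2 * int k \<le> b + int k + 1 \<and> (\<forall>x. y \<le> x \<longrightarrow> x < y + 2 * int k \<longrightarrow> g x = c)"
  proof (cases "\<exists>m. a \<le> m \<and> m \<le> b \<and> g m = lo + int (Suc M)")
    case True
    then obtain m where m: "a \<le> m" "m \<le> b" "g m = lo + int (Suc M)" by blast
    have "g x = g m" if "m - int k \<le> x" "x \<le> m + int k" for x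
      using that bd m by (intro harmonic_const_of_max[OF k harm]) auto
    then show ?thesis using m by (intro exI[of _ "m - int k"] exI[of _ "g m"]) auto
  next
    case False
    \<comment> \<open>Moving both ends inwards by k makes [a, b], where the top value is missing,
      the new window of values. This costs the length 2k that \<open>len\<close> allots to each
      value.\<close>
    have "\<exists>c. \<forall>x. (a + int k) - int k \<le> x \<longrightarrow> x \<le> (b - int k) + int k \<longrightarrow> g x = c"
    proof (rule Suc.IH)
      show "lo \<le> g x \<and> g x \<le> lo + int M" if "a + int k - int k \<le> x" "x \<le> b - int k + int k" for x
      proof -
        have "g x \<noteq> lo + int (Suc M)" using False that by auto
        then show ?thesis using bd[of x] that by auto
      qed
    qed (use harm len' in auto)
    then obtain c where "\<forall>x. a \<le> x \<longrightarrow> x \<le> b \<longrightarrow> g x = c" by auto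
    then show ?thesis using ab by (intro exI[of _ a] exI[of _ c]) auto
  qed
  then obtain y c where y: "a - int k \<le> y" "y + 2 * int k \<le> b + int k + 1"
    and c: "\<And>x. y \<le> x \<Longrightarrow> x < y + 2 * int k \<Longrightarrow> g x = c" by blast
  show ?case using harmonic_const[OF k harm c y] by blast
qed

lemma affine_of_const_diff:
  fixes \<phi> :: "int \<Rightarrow> int"
  assumes "\<And>x. lo \<le> x \<Longrightarrow> x < hi \<Longrightarrow> \<phi> (x + 1) - \<phi> x = s"
    and "lo \<le> y" "y \<le> x" "x \<le> hi"
  shows "\<phi> x = \<phi> y + s * (x - y)"
  using assms(3,4)
proof (induction x rule: int_ge_induct)
  case (step i)
  then show ?case using assms(1)[of i] assms(2) by (simp add: algebra_simps)
qed simp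

text \<open>The first difference of \<phi> is again harmonic, on an interval shorter by one, and its
  values lie in a range of width 2M; so it is constant.\<close>

lemma harmonic_affine:
  assumes k: "k \<ge> 1"
    and harm: "\<And>x. a \<le> x \<Longrightarrow> x \<le> b \<Longrightarrow> lap k \<phi> x = 0"
    and bd: "\<And>x. \<bar>\<phi> (x + 1) - \<phi> x\<bar> \<le> int M"
    and len: "4 * int k * int M < b - a"
  shows "\<exists>s. \<forall>x y. a - int k \<le> x \<longrightarrow> x \<le> b + int k \<longrightarrow> a - int k \<le> y \<longrightarrow> y \<le> b + int k
    \<longrightarrow> \<phi> x = \<phi> y + s * (x - y)"
proof -
  let ?g = "\<lambda>x. \<phi> (x + 1) - \<phi> x"
  have "\<exists>c. \<forall>x. a - int k \<le> x \<longrightarrow> x \<le> (b - 1) + int k \<longrightarrow> ?g x = c"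
  proof (rule bounded_harmonic_const[OF k])
    show "lap k ?g x = 0" if "a \<le> x" "x \<le> b - 1" for x
      using harm[of x] harm[of "x + 1"] that by (simp add: lap_diff lap_shift)
    show "- int M \<le> ?g x \<and> ?g x \<le> - int M + int (2 * M)" for x
      using bd[of x] by auto
  qed (use len in auto)
  then obtain s where s: "\<And>x. a - int k \<le> x \<Longrightarrow> x < b + int k \<Longrightarrow> ?g x = s" by force
  have "\<phi> x = \<phi> y + s * (x - y)" if "a - int k \<le> x" "x \<le> b + int k" "a - int k \<le> y" "y \<le> b + int k" for x y
  proof (cases "y \<le> x")
    case True
    then show ?thesis using affine_of_const_diff[of "a - int k" "b + int k" \<phi> s, OF s] that by blast
  next
    case False
    then have "\<phi> y = \<phi> x + s * (y - x)"
      using affine_of_const_diff[of "a - int k" "b + int k" \<phi> s x y, OF s] that by simp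
    then show ?thesis by (simp add: algebra_simps)
  qed
  then show ?thesis by blast
qed

section \<open>Cuts at a level, and counting\<close>

text \<open>The flow carried by slope one: between u and u + 1 pass j edges of each length j, and
  each of them carries j.\<close>

definition sigma :: "nat \<Rightarrow> nat" where
  "sigma k = (\<Sum>j=1..k. j * j)"

lemma sum_staircase: "(\<Sum>l<k. \<Sum>j=1..k. if l < j then int j else 0) = int (sigma k)"
proof -
  have "(\<Sum>l<k. \<Sum>j=1..k. if l < j then int j else 0) = (\<Sum>j=1..k. \<Sum>l<k. if l < j then int j else 0)"
    by (rule sum.swap)
  also have "\<dots> = (\<Sum>j=1..k. int (j * j))"
  proof (intro sum.cong refl)
    fix j assume "j \<in> {1..k}"
    then have "{..<k} \<inter> {l. l < j} = {..<j}" by auto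
    then show "(\<Sum>l<k. if l < j then int j else 0) = int (j * j)"
      by (simp add: sum.If_cases)
  qed
  finally show ?thesis by (simp add: sigma_def)
qed

text \<open>The function is strictly monotone near u, so the level c separates the ends of every
  edge passing over the gap from u to u + 1. The slope is a nonzero integer, so an edge of length j
  contributes at least j. Such an edge starts at u - l with l < j.\<close>

lemma sum_cut_term_affine:
  assumes affine: "\<And>x. u - int k < x \<Longrightarrow> x \<le> u + int k \<Longrightarrow> \<phi> x = \<phi> u + s * (x - u)"
    and cross: "\<phi> u < c \<and> c \<le> \<phi> (u + 1) \<or> \<phi> (u + 1) < c \<and> c \<le> \<phi> u"
  shows "int (sigma k) \<le> (\<Sum>x\<in>{u - int k<..u}. \<Sum>j=1..k. cut_term \<phi> c x j)"
proof (cases "k = 0")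
  case False
  have s: "\<phi> (u + 1) = \<phi> u + s" using affine[of "u + 1"] False by simp
  have "(if l < j then int j else 0) \<le> cut_term \<phi> c (u - int l) j" if "l < k" "j \<in> {1..k}" for l j
  proof (cases "l < j")
    case True
    have left: "\<phi> (u - int l) = \<phi> u - s * int l"
      using affine[of "u - int l"] that by simp
    have right: "\<phi> (u - int l + int j) = \<phi> u + s * (int j - int l)"
      using affine[of "u - int l + int j"] that True by simp
    have diff: "\<phi> (u - int l) - \<phi> (u - int l + int j) = - s * int j"
      using left right by (simp add: algebra_simps)
    show ?thesis
    proof (cases "s > 0")
      case True
      have "s * 1 \<le> s * (int j - int l)" using \<open>l < j\<close> True by (intro mult_left_mono) auto
      moreover have "0 \<le> s * int l" using True by simp
      ultimately have "\<phi> (u - int l) < c" "c \<le> \<phi> (u - int l + int j)"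
        using cross True left right s by linarith+
      moreover have "1 * int j \<le> s * int j" using True by (intro mult_right_mono) auto
      ultimately show ?thesis using diff \<open>l < j\<close> by (simp add: cut_term_def)
    next
      case False
      then have neg: "s < 0" using cross s by auto
      have "s * (int j - int l) \<le> s * 1" using \<open>l < j\<close> neg by (intro mult_left_mono_neg) auto
      moreover have "s * int l \<le> 0" using neg by (simp add: mult_nonpos_nonneg)
      ultimately have "c \<le> \<phi> (u - int l)" "\<phi> (u - int l + int j) < c"
        using cross neg left right s by linarith+
      moreover have "1 * int j \<le> (- s) * int j" using neg by (intro mult_right_mono) auto
      ultimately show ?thesis using diff \<open>l < j\<close> by (simp add: cut_term_def)
    qed
  qed (use cut_term_nonneg in auto)
  then have "int (sigma k) \<le> (\<Sum>l<k. \<Sum>j=1..k. cut_term \<phi> c (u - int l) j)"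
    unfolding sum_staircase[symmetric] by (intro sum_mono) auto
  also have "\<dots> = (\<Sum>x\<in>{u - int k<..u}. \<Sum>j=1..k. cut_term \<phi> c x j)"
    by (rule sum.reindex_bij_witness[of _ "\<lambda>x. nat (u - x)" "\<lambda>l. u - int l"]) auto
  finally show ?thesis .
qed (simp add: sigma_def)

text \<open>Pigeonhole: each of the m + 1 consecutive blocks that is not free uses up at least one
  of at most m units.\<close>

lemma zero_block:
  fixes h :: "int \<Rightarrow> int"
  assumes "\<And>x. 0 \<le> h x" "(\<Sum>x\<in>{a..<a + int (Suc m) * L}. h x) \<le> int m" "L \<ge> 0"
  shows "\<exists>b\<ge>a. b + L \<le> a + int (Suc m) * L \<and> (\<forall>x. b \<le> x \<longrightarrow> x < b + L \<longrightarrow> h x = 0)"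
  using assms(2)
proof (induction m arbitrary: a)
  case 0
  then have "(\<Sum>x\<in>{a..<a + L}. h x) = 0"
    using assms(1) by (simp add: antisym sum_nonneg)
  then have "\<forall>x\<in>{a..<a + L}. h x = 0"
    using assms(1) by (subst (asm) sum_nonneg_eq_0_iff) auto
  then show ?case by (intro exI[of _ a]) auto
next
  case (Suc m)
  show ?case
  proof (cases "\<forall>x. a \<le> x \<longrightarrow> x < a + L \<longrightarrow> h x = 0")
    case True
    then show ?thesis using assms(3) by (intro exI[of _ a]) (auto simp: algebra_simps)
  next
    case False
    then obtain y where y: "a \<le> y" "y < a + L" "h y \<noteq> 0" by auto
    have "h y \<le> (\<Sum>x\<in>{a..<a + L}. h x)"
      using y assms(1) by (intro member_le_sum) auto
    moreover have "1 \<le> h y" using y(3) assms(1)[of y] by linarith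
    moreover have "{a..<a + int (Suc (Suc m)) * L} = {a..<a + L} \<union> {a + L..<a + L + int (Suc m) * L}"
    proof -
      have "0 \<le> int (Suc m) * L" using assms(3) by simp
      moreover have "int (Suc (Suc m)) * L = L + int (Suc m) * L" by (simp add: algebra_simps)
      ultimately show ?thesis using assms(3) ivl_disj_un_two(3)[of a "a + L" "a + L + int (Suc m) * L"]
        by (simp add: add.assoc)
    qed
    then have "(\<Sum>x\<in>{a..<a + int (Suc (Suc m)) * L}. h x)
        = (\<Sum>x\<in>{a..<a + L}. h x) + (\<Sum>x\<in>{a + L..<a + L + int (Suc m) * L}. h x)"
      by (simp only:) (rule sum.union_disjoint, auto)
    ultimately have "(\<Sum>x\<in>{a + L..<a + L + int (Suc m) * L}. h x) \<le> int m"
      using Suc.prems by linarith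
    from Suc.IH[OF this] obtain b where "b \<ge> a + L" "b + L \<le> a + L + int (Suc m) * L"
      "\<forall>x. b \<le> x \<longrightarrow> x < b + L \<longrightarrow> h x = 0" by blast
    then show ?thesis using assms(3) by (intro exI[of _ b]) (auto simp: algebra_simps)
  qed
qed

lemma crossing_down:
  fixes \<phi> :: "int \<Rightarrow> int"
  assumes "p \<le> r" "c \<le> \<phi> p" "\<phi> r < c"
  shows "\<exists>i\<ge>p. i < r \<and> c \<le> \<phi> i \<and> \<phi> (i + 1) < c"
  using assms
proof (induction r rule: int_ge_induct)
  case (step r)
  then show ?case by (cases "\<phi> r < c") force+
qed simp

text \<open>Double counting: every counted position sees at least one unit of h in its window, and
  each unit lies in 2w + 1 windows.\<close>

lemma card_near_support:
  fixes h :: "int \<Rightarrow> int"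
  assumes per: "periodic n h" and n: "n > 0" and nn: "\<And>x. 0 \<le> h x"
    and sum: "(\<Sum>x\<in>{0..<n}. h x) \<le> int m"
  shows "card {i \<in> {a..<a + n}. \<exists>y. i - int w \<le> y \<and> y \<le> i + int w \<and> h y \<noteq> 0} \<le> (2 * w + 1) * m"
    (is "card ?B \<le> _")
proof -
  have "int (card ?B) = (\<Sum>i\<in>?B. 1)" by simp
  also have "\<dots> \<le> (\<Sum>i\<in>?B. \<Sum>t\<in>{- int w..int w}. h (i + t))"
  proof (rule sum_mono)
    fix i assume "i \<in> ?B"
    then obtain y where y: "i - int w \<le> y" "y \<le> i + int w" "h y \<noteq> 0" by blast
    have "1 \<le> h y" using y(3) nn[of y] by linarith
    also have "h y = h (i + (y - i))" by simp
    also have "\<dots> \<le> (\<Sum>t\<in>{- int w..int w}. h (i + t))"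
      using y nn by (intro member_le_sum[of "y - i"]) auto
    finally show "1 \<le> (\<Sum>t\<in>{- int w..int w}. h (i + t))" .
  qed
  also have "\<dots> \<le> (\<Sum>i\<in>{a..<a + n}. \<Sum>t\<in>{- int w..int w}. h (i + t))"
    by (intro sum_mono2 sum_nonneg nn) auto
  also have "\<dots> = (\<Sum>t\<in>{- int w..int w}. \<Sum>i\<in>{a..<a + n}. h (i + t))" by (rule sum.swap)
  also have "\<dots> = (\<Sum>t\<in>{- int w..int w}. \<Sum>x\<in>{0..<n}. h x)"
    by (simp add: periodic_sum_shift[OF per n] periodic_sum_start[OF per n])
  also have "\<dots> \<le> (\<Sum>t\<in>{- int w..int w}. int m)" using sum by (intro sum_mono)
  also have "\<dots> = int ((2 * w + 1) * m)" by (simp add: algebra_simps)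
  finally show ?thesis by (simp only: of_nat_le_iff)
qed

text \<open>A single step passes at most M integer levels. The contrapositive yields a level whose
  downward crossings all avoid B.\<close>

lemma card_crossed_levels:
  fixes \<phi> :: "int \<Rightarrow> int"
  assumes B: "finite B" and bd: "\<And>x. \<bar>\<phi> (x + 1) - \<phi> x\<bar> \<le> int M"
    and C: "\<And>c. c \<in> C \<Longrightarrow> \<exists>i\<in>B. \<phi> (i + 1) < c \<and> c \<le> \<phi> i"
  shows "card C \<le> card B * M"
proof -
  have sub: "C \<subseteq> (\<Union>i\<in>B. {\<phi> (i + 1)<..\<phi> i})" using C by force
  have "card C \<le> card (\<Union>i\<in>B. {\<phi> (i + 1)<..\<phi> i})" by (rule card_mono[OF _ sub]) (use B in auto)
  also have "\<dots> \<le> (\<Sum>i\<in>B. card {\<phi> (i + 1)<..\<phi> i})" by (rule card_UN_le[OF B])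
  also have "\<dots> \<le> (\<Sum>i\<in>B. M)"
  proof (rule sum_mono)
    show "card {\<phi> (i + 1)<..\<phi> i} \<le> M" for i using bd[of i] by simp
  qed
  finally show ?thesis by simp
qed

section \<open>The lower bound\<close>

lemma crossing_up:
  fixes \<phi> :: "int \<Rightarrow> int"
  assumes "p \<le> r" "\<phi> p < c" "c \<le> \<phi> r"
  shows "\<exists>i\<ge>p. i < r \<and> \<phi> i < c \<and> c \<le> \<phi> (i + 1)"
proof -
  \<comment> \<open>Negation turns \<open>\<phi> i < c\<close> into
    \<open>1 - c \<le> - \<phi> i\<close> over the integers, hence the shift of the level by
    one.\<close>
  obtain i where "p \<le> i" "i < r" "1 - c \<le> - \<phi> i" "- \<phi> (i + 1) < 1 - c"
    using crossing_down[of p r "1 - c" "\<lambda>x. - \<phi> x"] assms by auto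
  then show ?thesis by (intro exI[of _ i]) auto
qed

text \<open>Each level climbed in the run is crossed downwards before the period closes. There are
  more such levels than descents near a chip can account for, so some level c has all its descents
  in affine stretches. The ascent and one descent at c each contribute \<open>sigma k\<close> to the
  same cut.\<close>

lemma steep_run:
  assumes k: "k \<ge> 1" and n: "n > 0"
    and per: "periodic n \<phi>" "periodic n D" "periodic n E"
    and D: "\<And>x. 0 \<le> D x" "(\<Sum>x\<in>{0..<n}. D x) \<le> int m"
    and E: "\<And>x. 0 \<le> E x" "(\<Sum>x\<in>{0..<n}. E x) \<le> int m"
    and lap: "\<And>x. lap k \<phi> x = D x - E x"
    and run: "\<And>x. b \<le> x \<Longrightarrow> x < b + int \<Lambda> \<Longrightarrow> \<phi> x = \<phi> b + s * (x - b)"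
    and s: "s > 0"
    and \<Lambda>: "2 * k + 1 + (2 * (2 * k * m + 1) + 1) * (2 * m) * m < \<Lambda>" "int \<Lambda> \<le> n"
  shows "2 * sigma k \<le> m"
proof -
  \<comment> \<open>The window from i - w to i + w has length 4km + 2, just above the 4km that
    affineness requires.\<close>
  define w where "w = 2 * k * m + 1"
  define B where "B = {i \<in> {b..<b + n}. \<exists>y. i - int w \<le> y \<and> y \<le> i + int w \<and> D y + E y \<noteq> 0}"
  \<comment> \<open>The levels stay k places away from both ends of the run, so that every edge over
    the ascent has both ends in the run.\<close>
  define C where "C = {\<phi> (b + int k)<..\<phi> (b + int \<Lambda> - 1 - int k)}"
  have bd: "\<bar>\<phi> (x + 1) - \<phi> x\<bar> \<le> int m" for x
    using slope_le[OF per(1,2) n D(1) E(1) lap k, of x] D(2) by linarith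
  have "card B \<le> (2 * w + 1) * (2 * m)"
    unfolding B_def
  proof (rule card_near_support[OF _ n])
    show "periodic n (\<lambda>x. D x + E x)" using per by (simp add: periodic_def)
    show "(\<Sum>x\<in>{0..<n}. D x + E x) \<le> int (2 * m)" using D(2) E(2) by (simp add: sum.distrib)
  qed (use D E in auto)
  then have "card B * m \<le> (2 * w + 1) * (2 * m) * m" by (rule mult_right_mono) simp
  also have "\<dots> < \<Lambda> - (2 * k + 1)" using \<Lambda>(1) unfolding w_def by linarith
  also have "\<dots> \<le> card C"
  proof -
    have "\<phi> (b + int \<Lambda> - 1 - int k) - \<phi> (b + int k) = s * (int \<Lambda> - 1 - 2 * int k)"
      using run[of "b + int \<Lambda> - 1 - int k"] run[of "b + int k"] \<Lambda>(1) by (simp add: algebra_simps)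
    moreover have "1 * (int \<Lambda> - 1 - 2 * int k) \<le> s * (int \<Lambda> - 1 - 2 * int k)"
      using s \<Lambda>(1) by (intro mult_right_mono) auto
    ultimately show ?thesis by (simp add: C_def)
  qed
  finally have "\<not> card C \<le> card B * m" by simp
  moreover have "finite B" unfolding B_def by (rule finite_subset[of _ "{b..<b + n}"]) auto
  ultimately obtain c where c: "c \<in> C" and notB: "\<And>i. i \<in> B \<Longrightarrow> \<not> (\<phi> (i + 1) < c \<and> c \<le> \<phi> i)"
    using card_crossed_levels[of B \<phi> m C] bd by blast

  obtain u where u: "b + int k \<le> u" "u < b + int \<Lambda> - 1 - int k" "\<phi> u < c" "c \<le> \<phi> (u + 1)"
    using crossing_up[of "b + int k" "b + int \<Lambda> - 1 - int k" \<phi> c] c \<Lambda>(1) by (auto simp: C_def)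
  have up: "int (sigma k) \<le> (\<Sum>x\<in>{u - int k<..u}. \<Sum>j=1..k. cut_term \<phi> c x j)"
  proof (rule sum_cut_term_affine)
    show "\<phi> x = \<phi> u + s * (x - u)" if "u - int k < x" "x \<le> u + int k" for x
      using run[of x] run[of u] u that by (simp add: algebra_simps)
  qed (use u in auto)

  have "\<phi> (b + n) < c"
  proof -
    have "\<phi> (b + n) = \<phi> b" using per(1) by (simp add: periodic_def)
    also have "\<dots> \<le> \<phi> (b + int k)" using run[of "b + int k"] s \<Lambda>(1) by simp
    finally show ?thesis using c by (simp add: C_def)
  qed
  moreover have "c \<le> \<phi> (b + int \<Lambda> - 1)"
  proof -
    have "c \<le> \<phi> b + s * (int \<Lambda> - 1 - int k)"
      using c run[of "b + int \<Lambda> - 1 - int k"] \<Lambda>(1) by (simp add: C_def algebra_simps)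
    also have "\<dots> \<le> \<phi> b + s * (int \<Lambda> - 1)" using s by simp
    also have "\<dots> = \<phi> (b + int \<Lambda> - 1)" using run[of "b + int \<Lambda> - 1"] \<Lambda>(1) by (simp add: algebra_simps)
    finally show ?thesis .
  qed
  ultimately obtain i where i: "b + int \<Lambda> - 1 \<le> i" "i < b + n" "c \<le> \<phi> i" "\<phi> (i + 1) < c"
    using crossing_down[of "b + int \<Lambda> - 1" "b + n" c \<phi>] \<Lambda>(2) by auto
  have "i \<notin> B" using notB i by blast
  then have zero: "D y + E y = 0" if "i - int w \<le> y" "y \<le> i + int w" for y
    using i that \<Lambda>(1) by (auto simp: B_def)
  have "\<exists>s. \<forall>x y. (i - int w) - int k \<le> x \<longrightarrow> x \<le> (i + int w) + int k \<longrightarrow> (i - int w) - int k \<le> y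
      \<longrightarrow> y \<le> (i + int w) + int k \<longrightarrow> \<phi> x = \<phi> y + s * (x - y)"
  proof (rule harmonic_affine[OF k, where M = m])
    show "lap k \<phi> x = 0" if "i - int w \<le> x" "x \<le> i + int w" for x
      using zero[OF that] D(1)[of x] E(1)[of x] lap[of x] by linarith
  qed (auto intro: bd simp: w_def)
  then obtain s' where "\<And>x y. i - int w - int k \<le> x \<Longrightarrow> x \<le> i + int w + int k \<Longrightarrow> i - int w - int k \<le> y
      \<Longrightarrow> y \<le> i + int w + int k \<Longrightarrow> \<phi> x = \<phi> y + s' * (x - y)" by blast
  then have s': "\<phi> x = \<phi> i + s' * (x - i)" if "i - int k < x" "x \<le> i + int k" for x
    using that by auto
  have down: "int (sigma k) \<le> (\<Sum>x\<in>{i - int k<..i}. \<Sum>j=1..k. cut_term \<phi> c x j)"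
    by (rule sum_cut_term_affine[OF s']) (use i in auto)

  \<comment> \<open>The windows are disjoint because u lies more than k places before the last point
    of the run, and i at or after it.\<close>
  have "2 * int (sigma k) \<le> (\<Sum>x\<in>{u - int k<..u} \<union> {i - int k<..i}. \<Sum>j=1..k. cut_term \<phi> c x j)"
    using up down u i by (subst sum.union_disjoint) auto
  also have "\<dots> \<le> (\<Sum>x\<in>{b..<b + n}. \<Sum>j=1..k. cut_term \<phi> c x j)"
    using u i \<Lambda> by (intro sum_mono2 sum_nonneg cut_term_nonneg) auto
  also have "\<dots> \<le> (\<Sum>x\<in>{0..<n}. D x)"
    by (rule sum_cut_term_le[OF per(1,2) n D(1) E(1) lap])
  finally show ?thesis using D(2) by linarith
qed

text \<open>The net number of chips crossing from left to right between x and x + 1: the edges over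
  this gap start at x - t with t < j.\<close>

definition flow :: "nat \<Rightarrow> (int \<Rightarrow> int) \<Rightarrow> int \<Rightarrow> int" where
  "flow k \<phi> x = (\<Sum>j=1..k. \<Sum>t<j. \<phi> (x - int t) - \<phi> (x - int t + int j))"

text \<open>Conservation of chips at x. Moving the gap one place to the left shifts t by one, so the
  sum over t telescopes for each length j.\<close>

lemma flow_diff: "flow k \<phi> x - flow k \<phi> (x - 1) = lap k \<phi> x"
proof -
  have "(\<Sum>t<j. \<phi> (x - int t) - \<phi> (x - int t + int j)) - (\<Sum>t<j. \<phi> (x - 1 - int t) - \<phi> (x - 1 - int t + int j))
      = 2 * \<phi> x - \<phi> (x + int j) - \<phi> (x - int j)" for j
  proof -
    let ?h = "\<lambda>t. \<phi> (x - int t) - \<phi> (x - int t + int j)"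
    have "(\<Sum>t<j. ?h t) - (\<Sum>t<j. \<phi> (x - 1 - int t) - \<phi> (x - 1 - int t + int j)) = (\<Sum>t<j. ?h t - ?h (Suc t))"
      unfolding sum_subtractf[symmetric] by (intro sum.cong refl) (simp add: algebra_simps)
    also have "\<dots> = ?h 0 - ?h j" by (rule sum_lessThan_telescope')
    finally show ?thesis by simp
  qed
  then show ?thesis by (simp add: flow_def lap_def sum_subtractf[symmetric])
qed

lemma flow_antimono:
  assumes "\<And>x. a < x \<Longrightarrow> x \<le> b \<Longrightarrow> lap k \<phi> x \<le> 0" and "a \<le> b"
  shows "flow k \<phi> b \<le> flow k \<phi> a"
  using assms(2,1)
proof (induction b rule: int_ge_induct)
  case (step i)
  have "flow k \<phi> i \<le> flow k \<phi> a" by (rule step.IH) (use step.prems in auto)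
  then show ?case using flow_diff[of k \<phi> "i + 1"] step.prems[of "i + 1"] step.hyps by simp
qed simp

lemma flow_affine:
  assumes "\<And>y. x - int k < y \<Longrightarrow> y \<le> x + int k \<Longrightarrow> \<phi> y = \<phi> x + s * (y - x)"
  shows "flow k \<phi> x = - s * int (sigma k)"
proof -
  have "(\<Sum>t<j. \<phi> (x - int t) - \<phi> (x - int t + int j)) = - s * int (j * j)" if "j \<in> {1..k}" for j
  proof -
    have "(\<Sum>t<j. \<phi> (x - int t) - \<phi> (x - int t + int j)) = (\<Sum>t<j. - s * int j)"
    proof (intro sum.cong refl)
      fix t assume "t \<in> {..<j}"
      then show "\<phi> (x - int t) - \<phi> (x - int t + int j) = - s * int j"
        using assms[of "x - int t"] assms[of "x - int t + int j"] that by (simp add: algebra_simps)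
    qed
    then show ?thesis by simp
  qed
  then show ?thesis by (simp add: flow_def sigma_def sum_distrib_left)
qed

text \<open>Intended for \<open>n\<close>-periodic \<open>D\<close>, standing for a divisor on the cycle of length \<open>n\<close>.\<close>

definition positive_rank_on_cycle :: "nat \<Rightarrow> int \<Rightarrow> (int \<Rightarrow> int) \<Rightarrow> bool" where
  "positive_rank_on_cycle k n D \<longleftrightarrow>
    (\<forall>q. \<exists>\<phi>. periodic n \<phi> \<and> (\<forall>x. 0 \<le> D x - lap k \<phi> x) \<and> 1 \<le> D q - lap k \<phi> q)"

lemma sum_lap:
  assumes "periodic n \<phi>" "n > 0"
  shows "(\<Sum>x\<in>{0..<n}. lap k \<phi> x) = 0"
proof -
  have "(\<Sum>x\<in>{0..<n}. \<phi> (x + t)) = (\<Sum>x\<in>{0..<n}. \<phi> x)" for t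
    using periodic_sum_shift[OF assms, where a = 0 and j = t] by simp
  from this[of "int _"] this[of "- int _"] show ?thesis
    unfolding lap_def by (subst sum.swap) (simp add: sum_subtractf sum_distrib_left[symmetric])
qed

text \<open>Runs free of chips of both D and E exist on both sides of the middle of a gap of D.
  Their slopes differ, so one of them is nonzero and \<open>steep_run\<close> applies. The bound on
  \<Lambda> covers both affineness on a run and the demand of \<open>steep_run\<close>.\<close>

lemma effective_rank_lower_bound:
  assumes k: "k \<ge> 1"
    and L: "2 * k + 4 * k * m + 2 + (2 * (2 * k * m + 1) + 1) * (2 * m) * m < \<Lambda>"
    and n: "int (Suc m) * (2 * (int (Suc m) * int \<Lambda>) + 1) \<le> n"
    and perD: "periodic n D" and D: "\<And>x. 0 \<le> D x" "(\<Sum>x\<in>{0..<n}. D x) \<le> int m"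
    and rank: "positive_rank_on_cycle k n D"
  shows "2 * sigma k \<le> m"
proof -
  \<comment> \<open>With this length each half of the gap contains, by pigeonhole, a block of
    \<Lambda> places free of chips of E; the gap itself has length 2L + 1, with q in the
    middle.\<close>
  define L where "L = int (Suc m) * int \<Lambda>"
  have \<Lambda>L: "int \<Lambda> \<le> L" unfolding L_def by (simp add: algebra_simps)
  have "1 * (2 * L + 1) \<le> int (Suc m) * (2 * L + 1)"
    using \<Lambda>L by (intro mult_right_mono) auto
  then have Ln: "2 * L + 1 \<le> n" using n unfolding L_def mult_1 by (rule order_trans)
  then have n0: "n > 0" and \<Lambda>n: "int \<Lambda> \<le> n" using \<Lambda>L by linarith+
  have "(\<Sum>x\<in>{0..<0 + int (Suc m) * (2 * L + 1)}. D x) \<le> (\<Sum>x\<in>{0..<n}. D x)"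
    using n D(1) by (intro sum_mono2) (auto simp: L_def)
  then have "(\<Sum>x\<in>{0..<0 + int (Suc m) * (2 * L + 1)}. D x) \<le> int m" using D(2) by linarith
  moreover have "0 \<le> 2 * L + 1" using \<Lambda>L by linarith
  ultimately obtain a where a: "\<And>x. a \<le> x \<Longrightarrow> x < a + (2 * L + 1) \<Longrightarrow> D x = 0"
    using zero_block[where h = D, OF D(1)] by blast
  define q where "q = a + L"
  obtain \<phi> where per: "periodic n \<phi>" and E0: "\<And>x. 0 \<le> D x - lap k \<phi> x" and q: "1 \<le> D q - lap k \<phi> q"
    using rank unfolding positive_rank_on_cycle_def by blast
  define E where "E = (\<lambda>x. D x - lap k \<phi> x)"
  have E: "0 \<le> E x" for x using E0 by (simp add: E_def)
  have perE: "periodic n E" using perD periodic_lap[OF per] by (simp add: E_def periodic_def)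
  have sumE: "(\<Sum>x\<in>{0..<n}. E x) \<le> int m"
    using D(2) by (simp add: E_def sum_subtractf sum_lap[OF per n0])
  have lap: "lap k \<phi> x = D x - E x" for x by (simp add: E_def)
  have bd: "\<bar>\<phi> (x + 1) - \<phi> x\<bar> \<le> int m" for x
    using slope_le[OF per perD n0 D(1) E lap k, of x] D(2) by linarith
  have run: "\<exists>b s. p \<le> b \<and> b + int \<Lambda> \<le> p + L \<and> flow k \<phi> (b + int k) = - s * int (sigma k)
      \<and> (\<forall>x. b \<le> x \<longrightarrow> x < b + int \<Lambda> \<longrightarrow> \<phi> x = \<phi> b + s * (x - b))"
    if p: "a \<le> p" "p + L \<le> a + (2 * L + 1)" for p
  proof -
    have "(\<Sum>x\<in>{p..<p + L}. E x) \<le> (\<Sum>x\<in>{p..<p + n}. E x)"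
      using E Ln \<Lambda>L by (intro sum_mono2) auto
    then have "(\<Sum>x\<in>{p..<p + int (Suc m) * int \<Lambda>}. E x) \<le> int m"
      using sumE periodic_sum_start[OF perE n0, of p] by (simp add: L_def)
    then obtain b where b: "p \<le> b" "b + int \<Lambda> \<le> p + L"
      and Eb: "\<And>x. b \<le> x \<Longrightarrow> x < b + int \<Lambda> \<Longrightarrow> E x = 0"
      using zero_block[where h = E and a = p and m = m and L = "int \<Lambda>", OF E] unfolding L_def by auto
    have "\<exists>s. \<forall>x y. b - int k \<le> x \<longrightarrow> x \<le> (b + int \<Lambda> - 1) + int k \<longrightarrow> b - int k \<le> y
      \<longrightarrow> y \<le> (b + int \<Lambda> - 1) + int k \<longrightarrow> \<phi> x = \<phi> y + s * (x - y)"
    proof (rule harmonic_affine[OF k, where M = m])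
      show "lap k \<phi> x = 0" if "b \<le> x" "x \<le> b + int \<Lambda> - 1" for x
        using Eb[of x] a[of x] lap[of x] that b p by simp
      have "4 * k * m + 2 < \<Lambda>" using L by linarith
      then have "int (4 * k * m + 2) < int \<Lambda>" by (simp only: of_nat_less_iff)
      then show "4 * int k * int m < b + int \<Lambda> - 1 - b" by simp
    qed (rule bd)
    then obtain s where s: "\<And>x y. b - int k \<le> x \<Longrightarrow> x \<le> (b + int \<Lambda> - 1) + int k \<Longrightarrow> b - int k \<le> y
      \<Longrightarrow> y \<le> (b + int \<Lambda> - 1) + int k \<Longrightarrow> \<phi> x = \<phi> y + s * (x - y)" by blast
    have "flow k \<phi> (b + int k) = - s * int (sigma k)"
      by (rule flow_affine, rule s) (use L in auto)
    moreover have "\<phi> x = \<phi> b + s * (x - b)" if "b \<le> x" "x < b + int \<Lambda>" for x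
      using that by (intro s) auto
    ultimately show ?thesis using b by blast
  qed
  obtain b1 s1 where 1: "a \<le> b1" "b1 + int \<Lambda> \<le> q" "flow k \<phi> (b1 + int k) = - s1 * int (sigma k)"
    "\<And>x. b1 \<le> x \<Longrightarrow> x < b1 + int \<Lambda> \<Longrightarrow> \<phi> x = \<phi> b1 + s1 * (x - b1)"
    using run[of a] \<Lambda>L unfolding q_def by auto
  obtain b2 s2 where 2: "q + 1 \<le> b2" "b2 + int \<Lambda> \<le> q + 1 + L" "flow k \<phi> (b2 + int k) = - s2 * int (sigma k)"
    "\<And>x. b2 \<le> x \<Longrightarrow> x < b2 + int \<Lambda> \<Longrightarrow> \<phi> x = \<phi> b2 + s2 * (x - b2)"
    using run[of "q + 1"] \<Lambda>L unfolding q_def by auto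
  have nonpos: "lap k \<phi> x \<le> 0" if "a \<le> x" "x < a + (2 * L + 1)" for x
    using a[OF that] E[of x] lap[of x] by linarith
  have k\<Lambda>: "int k < int \<Lambda>" using L by linarith
  \<comment> \<open>Within the gap no place loses chips, so the flow never increases from left to
    right, and it drops strictly at q, which gains a chip.\<close>
  have "flow k \<phi> (b2 + int k) \<le> flow k \<phi> q"
    using 1 2 k\<Lambda> \<Lambda>L unfolding q_def by (intro flow_antimono nonpos) auto
  also have "\<dots> < flow k \<phi> (q - 1)"
    using flow_diff[of k \<phi> q] q a[of q] \<Lambda>L unfolding q_def by simp
  also have "\<dots> \<le> flow k \<phi> (b1 + int k)"
    using 1 2 k\<Lambda> \<Lambda>L unfolding q_def by (intro flow_antimono nonpos) auto
  finally have "s1 \<noteq> s2" using 1(3) 2(3) by auto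
  then obtain b s where s: "s \<noteq> 0"
    and b: "\<And>x. b \<le> x \<Longrightarrow> x < b + int \<Lambda> \<Longrightarrow> \<phi> x = \<phi> b + s * (x - b)"
    using 1(4) 2(4) by metis
  have L': "2 * k + 1 + (2 * (2 * k * m + 1) + 1) * (2 * m) * m < \<Lambda>" using L by linarith
  show ?thesis
  proof (cases "s > 0")
    case True
    show ?thesis by (rule steep_run[OF k n0 per perD perE D E sumE lap b True L' \<Lambda>n])
  next
    case False
    \<comment> \<open>The negated script leads from E back to D, so the two divisors exchange roles
      and the slope becomes positive.\<close>
    have "periodic n (\<lambda>x. - \<phi> x)" using per by (simp add: periodic_def)
    moreover have "lap k (\<lambda>x. - \<phi> x) x = E x - D x" for x using lap by (simp add: lap_minus)
    moreover have "- \<phi> x = - \<phi> b + (- s) * (x - b)" if "b \<le> x" "x < b + int \<Lambda>" for x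
      using b[OF that] by simp
    moreover have "- s > 0" using False s by simp
    ultimately show ?thesis
      using steep_run[OF k n0 _ perE perD E sumE D _ _ _ L' \<Lambda>n, of "\<lambda>x. - \<phi> x" b "- s"] by blast
  qed
qed

text \<open>Positive rank supplies an equivalent effective divisor of the same degree, again of
  positive rank. With m one less than twice \<open>sigma k\<close>, the threshold depends on k
  alone.\<close>

lemma rank_lower_bound:
  assumes k: "k \<ge> 1"
  shows "\<exists>N. \<forall>n D. N \<le> n \<longrightarrow> periodic n D \<longrightarrow> positive_rank_on_cycle k n D
    \<longrightarrow> 2 * int (sigma k) \<le> (\<Sum>x\<in>{0..<n}. D x)"
proof -
  define m where "m = 2 * sigma k - 1"
  have "1 \<le> sigma k" unfolding sigma_def using k member_le_sum[of 1 "{1..k}" "\<lambda>j. j * j"] by simp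
  then have m: "\<not> 2 * sigma k \<le> m" "2 * int (sigma k) = int m + 1" by (auto simp: m_def)
  obtain \<Lambda> where \<Lambda>: "2 * k + 4 * k * m + 2 + (2 * (2 * k * m + 1) + 1) * (2 * m) * m < \<Lambda>" by blast
  define N where "N = int (Suc m) * (2 * (int (Suc m) * int \<Lambda>) + 1)"
  have "2 * int (sigma k) \<le> (\<Sum>x\<in>{0..<n}. D x)"
    if n: "N \<le> n" and per: "periodic n D" and rank: "positive_rank_on_cycle k n D" for n D
  proof (rule ccontr)
    assume "\<not> ?thesis"
    then have small: "(\<Sum>x\<in>{0..<n}. D x) \<le> int m" using m by simp
    have "0 < N" unfolding N_def by (intro mult_pos_pos) auto
    then have n0: "n > 0" using n by simp
    obtain \<psi> where \<psi>: "periodic n \<psi>" and E: "\<And>x. 0 \<le> D x - lap k \<psi> x"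
      using rank unfolding positive_rank_on_cycle_def by blast
    define E where "E = (\<lambda>x. D x - lap k \<psi> x)"
    have "2 * sigma k \<le> m"
    proof (rule effective_rank_lower_bound[OF k \<Lambda>, of n E])
      show "periodic n E" using per periodic_lap[OF \<psi>] by (simp add: E_def periodic_def)
      show "(\<Sum>x\<in>{0..<n}. E x) \<le> int m"
        using small by (simp add: E_def sum_subtractf sum_lap[OF \<psi> n0])
      show "positive_rank_on_cycle k n E"
        unfolding positive_rank_on_cycle_def
      proof
        fix q
        obtain \<phi> where \<phi>: "periodic n \<phi>" "\<And>x. 0 \<le> D x - lap k \<phi> x" "1 \<le> D q - lap k \<phi> q"
          using rank unfolding positive_rank_on_cycle_def by blast
        show "\<exists>\<phi>. periodic n \<phi> \<and> (\<forall>x. 0 \<le> E x - lap k \<phi> x) \<and> 1 \<le> E q - lap k \<phi> q"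
          using \<phi> \<psi> by (intro exI[of _ "\<lambda>x. \<phi> x - \<psi> x"]) (simp add: lap_diff E_def periodic_def)
      qed
    qed (use E n in \<open>auto simp: E_def N_def\<close>)
    then show False using m(1) by simp
  qed
  then show ?thesis by blast
qed

section \<open>The upper bound\<close>

definition point :: "int \<Rightarrow> int \<Rightarrow> int \<Rightarrow> int" where
  "point n t x = of_bool ((x - t) mod n = 0)"

lemma periodic_point: "periodic n (point n t)"
proof -
  have "(x + n - t) mod n = (x - t) mod n" for x
    using mod_add_self2[of "x - t" n] by (simp add: algebra_simps)
  then show ?thesis by (simp add: periodic_def point_def)
qed

lemma point_shift: "point n t (x + j) = point n (t - j) x"
  by (simp add: point_def algebra_simps)

lemma sum_point:
  assumes "n > 0" shows "(\<Sum>x\<in>{0..<n}. point n t x) = 1"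
proof -
  have "point n t x = (if x = t mod n then 1 else 0)" if "x \<in> {0..<n}" for x
    using that by (auto simp: point_def mod_eq_0_iff_dvd mod_eq_dvd_iff[symmetric])
  then have "(\<Sum>x\<in>{0..<n}. point n t x) = (\<Sum>x\<in>{0..<n}. if x = t mod n then 1 else 0)"
    by (rule sum.cong[OF refl])
  then show ?thesis using assms by simp
qed

text \<open>
  At distance \<open>i\<close> from \<open>c\<close>, before reduction modulo \<open>n\<close>, the value is \<open>\<Sum>j=1..k. max 0 (j - i)\<close>, the
  negated Laplacian of \<open>\<lambda>x. max 0 (x - c)\<close>. Summing over \<open>a\<close> and \<open>b\<close> makes its second differences
  in \<open>c\<close> telescope.
\<close>

definition packet :: "nat \<Rightarrow> int \<Rightarrow> int \<Rightarrow> int \<Rightarrow> int" where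
  "packet k n c x = (\<Sum>j=1..k. \<Sum>a<j. \<Sum>b<j. point n (c + int a - int b) x)"

text \<open>The effect of firing c once. The first difference in c telescopes over a, the second
  over b, and what remains for each j is supported at c - j, c and c + j.\<close>

lemma packet_second_difference:
  "packet k n (c + 1) x + packet k n (c - 1) x = 2 * packet k n c x - lap k (point n c) x"
proof -
  let ?d = "\<lambda>t. point n t x"
  have "(\<Sum>a<j. \<Sum>b<j. ?d (c + 1 + int a - int b)) + (\<Sum>a<j. \<Sum>b<j. ?d (c - 1 + int a - int b))
      = 2 * (\<Sum>a<j. \<Sum>b<j. ?d (c + int a - int b)) - (2 * ?d c - point n c (x + int j) - point n c (x - int j))" for j
  proof -
    let ?S = "\<lambda>c. \<Sum>a<j. \<Sum>b<j. ?d (c + int a - int b)"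
    have diff: "?S (c + 1) - ?S c = (\<Sum>b<j. ?d (c + int j - int b) - ?d (c - int b))" for c
    proof -
      have "?S (c + 1) - ?S c = (\<Sum>a<j. (\<Sum>b<j. ?d (c + int (Suc a) - int b)) - (\<Sum>b<j. ?d (c + int a - int b)))"
        by (simp add: sum_subtractf algebra_simps)
      also have "\<dots> = (\<Sum>b<j. ?d (c + int j - int b)) - (\<Sum>b<j. ?d (c + int 0 - int b))"
        by (rule sum_lessThan_telescope)
      finally show ?thesis by (simp add: sum_subtractf)
    qed
    let ?h = "\<lambda>b. ?d (c + int j - int b) - ?d (c - int b)"
    have "(?S (c + 1) - ?S c) - (?S (c - 1 + 1) - ?S (c - 1))
        = (\<Sum>b<j. ?h b) - (\<Sum>b<j. ?d (c - 1 + int j - int b) - ?d (c - 1 - int b))"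
      by (simp only: diff)
    also have "\<dots> = (\<Sum>b<j. ?h b - ?h (Suc b))"
      by (simp add: sum_subtractf sum.distrib algebra_simps)
    also have "\<dots> = ?h 0 - ?h j" by (rule sum_lessThan_telescope')
    finally show ?thesis
      using point_shift[of n c x "int j"] point_shift[of n c x "- int j"] by simp
  qed
  then show ?thesis
    by (simp add: packet_def lap_def sum.distrib[symmetric] sum_subtractf[symmetric] sum_distrib_left)
qed

lemma packet_nonneg: "0 \<le> packet k n c x"
  by (simp add: packet_def point_def sum_nonneg)

lemma packet_center:
  assumes "k \<ge> 1" "x mod n = c mod n" shows "1 \<le> packet k n c x"
proof -
  let ?t = "\<lambda>j. \<Sum>a<j. \<Sum>b<j. point n (c + int a - int b) x"
  have "(x - c) mod n = 0" using assms(2) by (simp add: mod_eq_0_iff_dvd mod_eq_dvd_iff)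
  then have "1 = ?t 1" by (simp add: point_def)
  also have "\<dots> \<le> (\<Sum>j=1..k. ?t j)"
    using assms(1) by (intro member_le_sum[of 1] sum_nonneg) (auto simp: point_def)
  finally show ?thesis by (simp add: packet_def)
qed

lemma periodic_packet: "periodic n (packet k n c)"
  using periodic_point by (simp add: periodic_def packet_def)

lemma sum_packet:
  assumes "n > 0" shows "(\<Sum>x\<in>{0..<n}. packet k n c x) = int (sigma k)"
proof -
  have "(\<Sum>x\<in>{0..<n}. packet k n c x) = (\<Sum>j=1..k. \<Sum>a<j. \<Sum>b<j. \<Sum>x\<in>{0..<n}. point n (c + int a - int b) x)"
    unfolding packet_def
    by (subst sum.swap, intro sum.cong refl, subst sum.swap, intro sum.cong refl, rule sum.swap)
  then show ?thesis by (simp add: sum_point[OF assms] sigma_def)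
qed

text \<open>Adding the second difference relations at t and - t gives a two-step recursion for the
  symmetric pairs. It starts with equivalent pairs at r = 0 and r = 1, so all pairs are
  equivalent.\<close>

lemma packet_pair_spread:
  "\<exists>\<phi>. periodic n \<phi> \<and> (\<forall>x. packet k n (int r) x + packet k n (- int r) x = 2 * packet k n 0 x - lap k \<phi> x)"
proof (induction r rule: less_induct)
  case (less r)
  consider "r = 0" | "r = 1" | s where "r = Suc (Suc s)"
    by (metis One_nat_def not0_implies_Suc)
  then show ?case
  proof cases
    case 1
    then show ?thesis by (intro exI[of _ "\<lambda>_. 0"]) (simp add: periodic_def lap_def)
  next
    case 2
    then show ?thesis using packet_second_difference[of k n 0] periodic_point
      by (intro exI[of _ "point n 0"]) auto
  next
    case 3
    define t where "t = int s + 1"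
    have r: "int r = t + 1" and s: "int s = t - 1" and ss: "int (Suc s) = t" using 3 by (auto simp: t_def)
    obtain \<phi> where \<phi>: "periodic n \<phi>"
      "\<And>x. packet k n (t - 1) x + packet k n (- (t - 1)) x = 2 * packet k n 0 x - lap k \<phi> x"
      using less.IH[of s] 3 unfolding s by auto
    obtain \<psi> where \<psi>: "periodic n \<psi>"
      "\<And>x. packet k n t x + packet k n (- t) x = 2 * packet k n 0 x - lap k \<psi> x"
      using less.IH[of "Suc s"] 3 unfolding ss by auto
    \<comment> \<open>Twice the script for t minus the script for t - 1, followed by one firing at
      each of t and - t.\<close>
    let ?f = "\<lambda>x. (\<psi> x + \<psi> x - \<phi> x) + (point n t x + point n (- t) x)"
    have "periodic n ?f" using \<phi>(1) \<psi>(1) periodic_point[of n] by (simp add: periodic_def)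
    moreover have "packet k n (t + 1) x + packet k n (- (t + 1)) x = 2 * packet k n 0 x - lap k ?f x" for x
    proof -
      have "- t - 1 = - (t + 1)" "- t + 1 = - (t - 1)" by auto
      then show ?thesis
        using \<phi>(2)[of x] \<psi>(2)[of x] packet_second_difference[of k n t x] packet_second_difference[of k n "- t" x]
        unfolding lap_add lap_diff by simp
    qed
    ultimately show ?thesis unfolding r by blast
  qed
qed

text \<open>Spreading the pair by the residue of q places a packet centred at q modulo n; the other
  packet is nonnegative.\<close>

lemma rank_packet:
  assumes "k \<ge> 1" "n > 0"
  shows "positive_rank_on_cycle k n (\<lambda>x. 2 * packet k n 0 x)"
  unfolding positive_rank_on_cycle_def
proof
  fix q
  let ?r = "nat (q mod n)"
  obtain \<phi> where \<phi>: "periodic n \<phi>"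
    "\<And>x. packet k n (int ?r) x + packet k n (- int ?r) x = 2 * packet k n 0 x - lap k \<phi> x"
    using packet_pair_spread by blast
  have "1 \<le> packet k n (int ?r) q" using assms by (intro packet_center) auto
  then have "1 \<le> 2 * packet k n 0 q - lap k \<phi> q"
    using packet_nonneg[of k n "- int ?r" q] \<phi>(2)[of q] by linarith
  moreover have "0 \<le> 2 * packet k n 0 x - lap k \<phi> x" for x
    using packet_nonneg[of k n _ x] unfolding \<phi>(2)[symmetric] by simp
  ultimately show "\<exists>\<phi>. periodic n \<phi> \<and> (\<forall>x. 0 \<le> 2 * packet k n 0 x - lap k \<phi> x) \<and> 1 \<le> 2 * packet k n 0 q - lap k \<phi> q"
    using \<phi>(1) by blast
qed

section \<open>Harary graphs\<close>

context connected_multigraph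
begin

text \<open>The outcome of firing each v exactly f v times in any order, negative counts being
  reverse firings. Only differences of f enter, so adding a constant to f changes nothing.\<close>

definition fire_script :: "('v \<Rightarrow> int) \<Rightarrow> ('v \<Rightarrow> int) \<Rightarrow> 'v \<Rightarrow> int" where
  "fire_script f D w = D w - (\<Sum>u\<in>verts G. int (mult G w u) * (f w - f u))"

lemma fire_fire_script:
  assumes "v \<in> verts G"
  shows "fire G v (fire_script f D) = fire_script (f(v := f v + 1)) D"
proof
  fix w
  have "(\<Sum>u\<in>verts G. int (mult G w u) * ((f(v := f v + 1)) w - (f(v := f v + 1)) u))
      = (\<Sum>u\<in>verts G. int (mult G w u) * (f w - f u)
          + ((if w = v then int (mult G v u) else 0) - (if u = v then int (mult G w v) else 0)))"
    by (intro sum.cong refl) (auto simp: algebra_simps loopless)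
  also have "\<dots> = (\<Sum>u\<in>verts G. int (mult G w u) * (f w - f u))
      + (if w = v then \<Sum>u\<in>verts G. int (mult G v u) else 0) - int (mult G v w)"
    using assms finite_verts by (simp add: sum.distrib sum_subtractf mult_sym[of w])
  finally show "fire G v (fire_script f D) w = fire_script (f(v := f v + 1)) D w"
    by (simp add: fire_eq fire_script_def)
qed

lemma equivalent_imp_fire_script:
  assumes "equivalent G D E" shows "\<exists>f. E = fire_script f D"
  using assms unfolding equivalent_def
proof (induction rule: rtranclp_induct)
  case base
  show ?case by (intro exI[of _ "\<lambda>_. 0"]) (simp add: fire_script_def)
next
  case (step E F)
  then show ?case using fire_fire_script by blast
qed

text \<open>Induction on the total number of firings, splitting off one at a vertex with a positive
  count.\<close>

lemma equivalent_fire_script_nat: "equivalent G D (fire_script (\<lambda>v. int (f v)) D)"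
proof (induction "\<Sum>v\<in>verts G. f v" arbitrary: f)
  case 0
  then have "f v = 0" if "v \<in> verts G" for v using that finite_verts by simp
  then have "fire_script (\<lambda>v. int (f v)) D w = D w" for w
    by (cases "w \<in> verts G") (simp_all add: fire_script_def mult_outside)
  then have "fire_script (\<lambda>v. int (f v)) D = D" by blast
  then show ?case by (simp add: equivalent_def)
next
  case (Suc N)
  have "\<exists>v\<in>verts G. f v \<noteq> 0" using Suc.hyps(2) by (metis sum.neutral nat.simps(3))
  then obtain v where v: "v \<in> verts G" "f v \<noteq> 0" by blast
  let ?f = "f(v := f v - 1)"
  have "Suc N = f v + (\<Sum>u\<in>verts G - {v}. f u)"
    using Suc.hyps(2) v(1) finite_verts by (simp add: sum.remove)
  then have "N = (\<Sum>u\<in>verts G. ?f u)"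
    using v finite_verts by (simp add: sum.remove[of _ v])
  from Suc.hyps(1)[OF this] have "equivalent G D (fire_script (\<lambda>v. int (?f v)) D)" .
  moreover have "(\<lambda>u. int (f u)) = (\<lambda>u. int (?f u))(v := int (?f v) + 1)"
    using v(2) by (auto simp: fun_eq_iff)
  then have "fire_script (\<lambda>v. int (f v)) D = fire G v (fire_script (\<lambda>v. int (?f v)) D)"
    unfolding fire_fire_script[OF v(1)] by (rule arg_cong)
  ultimately show ?case unfolding equivalent_def
    using v(1) by (auto intro: rtranclp.rtrancl_into_rtrancl)
qed

text \<open>Subtracting the minimum of f makes all counts on the vertices nonnegative and leaves the
  outcome unchanged.\<close>

lemma equivalent_fire_script: "equivalent G D (fire_script f D)"
proof -
  let ?m = "Min (f ` verts G)"
  let ?f = "\<lambda>v. nat (f v - ?m)"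
  have f: "int (?f v) = f v - ?m" if "v \<in> verts G" for v
    using that finite_verts by simp
  have "fire_script (\<lambda>v. int (?f v)) D w = fire_script f D w" for w
  proof (cases "w \<in> verts G")
    case True
    then show ?thesis unfolding fire_script_def by (intro arg_cong2[of _ _ _ _ minus] refl sum.cong) (simp only: f, simp)
  qed (simp add: fire_script_def mult_outside)
  then have "fire_script (\<lambda>v. int (?f v)) D = fire_script f D" by blast
  then show ?thesis using equivalent_fire_script_nat[of D ?f] by simp
qed

end

section \<open>Unrolling the Harary graph to the integers\<close>

definition vertex :: "nat \<Rightarrow> int \<Rightarrow> nat" where
  "vertex n x = nat ((x - 1) mod int n) + 1"

lemma vertex_in: "n > 0 \<Longrightarrow> vertex n x \<in> {1..n}"
  using pos_mod_bound[of "int n" "x - 1"] by (auto simp: vertex_def simp del: pos_mod_bound)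

lemma vertex_of_nat: "v \<in> {1..n} \<Longrightarrow> vertex n (int v) = v"
  by (simp add: vertex_def nat_diff_distrib)

lemma vertex_eq_iff:
  assumes "v \<in> {1..n}" shows "vertex n y = v \<longleftrightarrow> (int v - y) mod int n = 0"
proof -
  have "vertex n y = v \<longleftrightarrow> (y - 1) mod int n = (int v - 1) mod int n"
    using assms pos_mod_sign[of "int n" "y - 1"] by (auto simp: vertex_def)
  also have "\<dots> \<longleftrightarrow> (int v - y) mod int n = 0"
    by (auto simp: mod_eq_dvd_iff mod_eq_0_iff_dvd dvd_diff_commute)
  finally show ?thesis .
qed

lemma periodic_vertex: "periodic (int n) (\<lambda>x. f (vertex n x))"
  by (simp add: periodic_def vertex_def add_diff_eq[symmetric] add.commute[of _ "int n"])

lemma periodic_add_mult: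
  assumes "periodic n h" shows "h (x + n * i) = h x"
proof (induction i rule: int_induct[where k = 0])
  case (step1 i)
  have "h ((x + n * i) + n) = h (x + n * i)" using assms unfolding periodic_def by blast
  then show ?case using step1 by (simp add: algebra_simps)
next
  case (step2 i)
  have "h ((x + n * (i - 1)) + n) = h (x + n * (i - 1))" using assms unfolding periodic_def by blast
  then show ?case using step2 by (simp add: algebra_simps)
qed simp

lemma periodic_at_vertex:
  assumes "periodic (int n) h" "n > 0"
  shows "h (int (vertex n x)) = h x"
proof -
  have "x = int (vertex n x) + int n * ((x - 1) div int n)"
    using assms(2) by (simp add: vertex_def)
  then show ?thesis using periodic_add_mult[OF assms(1)] by metis
qed

text \<open>Because n is at least 2k + 1, the residues of j and - j for j up to k are distinct and
  nonzero. So at most one term of the sum is 1, in accordance with simple edges.\<close>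

lemma mult_harary:
  assumes n: "n \<ge> 2 * k + 1" and v: "v \<in> {1..n}" and u: "u \<in> {1..n}"
  shows "int (mult (harary k n) v u)
    = (\<Sum>j=1..k. of_bool ((int u - (int v + int j)) mod int n = 0) + of_bool ((int u - (int v - int j)) mod int n = 0))"
proof -
  define r where "r = (int u - int v) mod int n"
  have r: "0 \<le> r" "r < int n" using n by (auto simp: r_def)
  have r': "(int v - int u) mod int n = (if r = 0 then 0 else int n - r)"
    using zmod_zminus1_eq_if[of "int u - int v" "int n"] by (simp add: r_def)
  have plus: "(int u - (int v + int j)) mod int n = 0 \<longleftrightarrow> r = int j" if "j \<in> {1..k}" for j
  proof -
    have "(int u - (int v + int j)) mod int n = 0 \<longleftrightarrow> r = int j mod int n"
      unfolding r_def by (simp add: mod_eq_dvd_iff mod_eq_0_iff_dvd algebra_simps)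
    then show ?thesis using that n by simp
  qed
  have minus: "(int u - (int v - int j)) mod int n = 0 \<longleftrightarrow> int n - r = int j" if "j \<in> {1..k}" for j
  proof -
    have "(int u - (int v - int j)) mod int n = 0 \<longleftrightarrow> int n dvd (int u - int v) - (- int j)"
      by (simp add: mod_eq_0_iff_dvd algebra_simps)
    also have "\<dots> \<longleftrightarrow> r = (- int j) mod int n" unfolding r_def by (simp add: mod_eq_dvd_iff)
    also have "(- int j) mod int n = int n - int j"
      using that n by (simp add: zmod_zminus1_eq_if)
    finally show ?thesis by auto
  qed
  have count: "(\<Sum>j=1..k. of_bool (t = int j)) = (of_bool (1 \<le> t \<and> t \<le> int k) :: int)" for t :: int
  proof (cases "1 \<le> t \<and> t \<le> int k")
    case True
    have "(\<Sum>j=1..k. of_bool (t = int j)) = (\<Sum>j=1..k. if j = nat t then 1 else 0 :: int)"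
      using True by (intro sum.cong) auto
    moreover have "nat t \<in> {1..k}" using True by (simp add: nat_le_iff le_nat_iff)
    ultimately show ?thesis using True by simp
  qed (auto intro: sum.neutral)
  have "(\<Sum>j=1..k. of_bool ((int u - (int v + int j)) mod int n = 0) + of_bool ((int u - (int v - int j)) mod int n = 0))
      = (\<Sum>j=1..k. of_bool (r = int j)) + (\<Sum>j=1..k. of_bool (int n - r = int j) :: int)"
    unfolding sum.distrib[symmetric] by (intro sum.cong refl) (simp only: plus minus)
  also have "\<dots> = of_bool (1 \<le> r \<and> r \<le> int k) + of_bool (1 \<le> int n - r \<and> int n - r \<le> int k)"
    unfolding count ..
  also have "\<dots> = int (mult (harary k n) v u)"
    using n v u r by (auto simp: harary_def r' r_def[symmetric])
  finally show ?thesis ..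
qed

lemma sum_mult_harary:
  assumes n: "n \<ge> 2 * k + 1" and v: "v \<in> {1..n}"
  shows "(\<Sum>u\<in>{1..n}. int (mult (harary k n) v u) * h u)
    = (\<Sum>j=1..k. h (vertex n (int v + int j)) + h (vertex n (int v - int j)))"
proof -
  have n0: "n > 0" using n by simp
  have pick: "(\<Sum>u\<in>{1..n}. of_bool ((int u - y) mod int n = 0) * h u) = h (vertex n y)" for y
  proof -
    have "(\<Sum>u\<in>{1..n}. of_bool ((int u - y) mod int n = 0) * h u)
        = (\<Sum>u\<in>{1..n}. if u = vertex n y then h u else 0)"
      by (intro sum.cong refl) (auto simp: vertex_eq_iff[symmetric])
    then show ?thesis using vertex_in[OF n0, of y] by simp
  qed
  have "(\<Sum>u\<in>{1..n}. int (mult (harary k n) v u) * h u)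
      = (\<Sum>u\<in>{1..n}. \<Sum>j=1..k. of_bool ((int u - (int v + int j)) mod int n = 0) * h u
          + of_bool ((int u - (int v - int j)) mod int n = 0) * h u)"
    by (intro sum.cong refl) (simp only: mult_harary[OF n v] sum_distrib_right distrib_right)
  also have "\<dots> = (\<Sum>j=1..k. \<Sum>u\<in>{1..n}. of_bool ((int u - (int v + int j)) mod int n = 0) * h u
          + of_bool ((int u - (int v - int j)) mod int n = 0) * h u)"
    by (rule sum.swap)
  finally show ?thesis by (simp only: sum.distrib pick)
qed

lemma verts_harary: "verts (harary k n) = {1..n}"
  by (simp add: harary_def)

lemma fire_script_harary:
  assumes k: "k \<ge> 1" and n: "n \<ge> 2 * k + 1" and v: "v \<in> {1..n}"
  shows "connected_multigraph.fire_script (harary k n) f D v = D v - lap k (\<lambda>x. f (vertex n x)) (int v)"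
proof -
  interpret connected_multigraph "harary k n" using k n by (rule connected_multigraph_harary)
  have "(\<Sum>u\<in>{1..n}. int (mult (harary k n) v u) * (f v - f u)) = lap k (\<lambda>x. f (vertex n x)) (int v)"
    using sum_mult_harary[OF n v, of "\<lambda>u. f v - f u"] vertex_of_nat[OF v]
    by (simp add: lap_def algebra_simps)
  then show ?thesis by (simp add: fire_script_def verts_harary)
qed

lemma degree_harary:
  "(\<Sum>x\<in>{0..<int n}. D (vertex n x)) = degree (harary k n) D"
proof (cases "n = 0")
  case False
  have "(\<Sum>x\<in>{0..<int n}. D (vertex n x)) = (\<Sum>x\<in>{1..<1 + int n}. D (vertex n x))"
    using periodic_sum_start[OF periodic_vertex, of n D 1] False by simp
  also have "\<dots> = (\<Sum>v\<in>{1..n}. D v)"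
    by (rule sum.reindex_bij_witness[of _ int nat]) (auto simp: vertex_def Suc_nat_eq_nat_zadd1)
  finally show ?thesis by (simp add: degree_def verts_harary)
qed (simp add: degree_def verts_harary)

text \<open>An equivalence is a script, which unrolls to a periodic function; the chip removed at q
  is returned at all unrolled copies of q.\<close>

lemma positive_rank_unroll:
  assumes k: "k \<ge> 1" and n: "n \<ge> 2 * k + 1" and rank: "positive_rank (harary k n) D"
  shows "positive_rank_on_cycle k (int n) (\<lambda>x. D (vertex n x))"
  unfolding positive_rank_on_cycle_def
proof
  interpret connected_multigraph "harary k n" using k n by (rule connected_multigraph_harary)
  have n0: "n > 0" using n by simp
  fix q
  let ?q = "vertex n q"
  obtain E where E: "effective (harary k n) E" "equivalent (harary k n) (D(?q := D ?q - 1)) E"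
    using rank vertex_in[OF n0, of q] unfolding positive_rank_def verts_harary by blast
  then obtain f where f: "E = fire_script f (D(?q := D ?q - 1))"
    using equivalent_imp_fire_script by blast
  let ?\<phi> = "\<lambda>x. f (vertex n x)"
  have *: "D (vertex n x) - lap k ?\<phi> x = E (vertex n x) + (if vertex n x = ?q then 1 else 0)"
    and **: "0 \<le> E (vertex n x)" for x
  proof -
    have "lap k ?\<phi> (int (vertex n x)) = lap k ?\<phi> x"
      by (rule periodic_at_vertex[OF periodic_lap[OF periodic_vertex] n0])
    then show "D (vertex n x) - lap k ?\<phi> x = E (vertex n x) + (if vertex n x = ?q then 1 else 0)"
      unfolding f fire_script_harary[OF k n vertex_in[OF n0]] by auto
    show "0 \<le> E (vertex n x)"
      using E(1) vertex_in[OF n0, of x] by (auto simp: effective_def verts_harary)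
  qed
  show "\<exists>\<phi>. periodic (int n) \<phi> \<and> (\<forall>x. 0 \<le> D (vertex n x) - lap k \<phi> x) \<and> 1 \<le> D (vertex n q) - lap k \<phi> q"
    using periodic_vertex[of n f] * ** by (intro exI[of _ ?\<phi>]) simp
qed

lemma positive_rank_roll:
  assumes k: "k \<ge> 1" and n: "n \<ge> 2 * k + 1"
    and rank: "positive_rank_on_cycle k (int n) D"
  shows "positive_rank (harary k n) (\<lambda>v. if v \<in> {1..n} then D (int v) else 0)" (is "positive_rank _ ?D")
  unfolding positive_rank_def
proof
  interpret connected_multigraph "harary k n" using k n by (rule connected_multigraph_harary)
  have n0: "n > 0" using n by simp
  fix q assume q: "q \<in> verts (harary k n)"
  obtain \<phi> where \<phi>: "periodic (int n) \<phi>" "\<And>x. 0 \<le> D x - lap k \<phi> x" "1 \<le> D (int q) - lap k \<phi> (int q)"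
    using rank unfolding positive_rank_on_cycle_def by blast
  let ?E = "fire_script (\<lambda>v. \<phi> (int v)) (?D(q := ?D q - 1))"
  have "(\<lambda>x. \<phi> (int (vertex n x))) = \<phi>" using periodic_at_vertex[OF \<phi>(1) n0] by blast
  then have E: "?E v = (?D(q := ?D q - 1)) v - lap k \<phi> (int v)" if "v \<in> {1..n}" for v
    using fire_script_harary[OF k n that] by simp
  have "effective (harary k n) ?E"
    unfolding effective_def verts_harary
  proof
    fix v assume v: "v \<in> {1..n}"
    show "0 \<le> ?E v" unfolding E[OF v] using v \<phi>(2)[of "int v"] \<phi>(3) by auto
  qed
  moreover have "?E \<in> divisors (harary k n)"
    using q by (auto simp: divisors_def fire_script_def mult_outside verts_harary)
  moreover have "equivalent (harary k n) (?D(q := ?D q - 1)) ?E" by (rule equivalent_fire_script)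
  ultimately show "\<exists>E\<in>divisors (harary k n). effective (harary k n) E \<and> equivalent (harary k n) (?D(q := ?D q - 1)) E"
    by blast
qed

section \<open>The gonality for large n\<close>

lemma gonality_harary:
  assumes k: "k \<ge> 1"
  shows "\<exists>N. \<forall>n\<ge>N. gonality (harary k n) = 2 * sigma k"
proof -
  obtain N where N: "\<And>n D. N \<le> n \<Longrightarrow> periodic n D \<Longrightarrow> positive_rank_on_cycle k n D
    \<Longrightarrow> 2 * int (sigma k) \<le> (\<Sum>x\<in>{0..<n}. D x)"
    using rank_lower_bound[OF k] by blast
  \<comment> \<open>The threshold N is an integer, hence \<open>nat N\<close>; the bound 2k + 1
    makes the passage between graph and cycle valid.\<close>
  have "gonality (harary k n) = 2 * sigma k" if n: "n \<ge> max (nat N) (2 * k + 1)" for n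
    unfolding gonality_def
  proof (rule Least_equality)
    have n': "n \<ge> 2 * k + 1" and n0: "n > 0" using n by auto
    let ?P = "\<lambda>x. 2 * packet k (int n) 0 x"
    let ?D = "\<lambda>v. if v \<in> {1..n} then ?P (int v) else 0"
    have per: "periodic (int n) ?P" using periodic_packet by (simp add: periodic_def)
    have "?D (vertex n x) = ?P x" for x
      using vertex_in[OF n0, of x] periodic_at_vertex[OF per n0, of x] by simp
    then have "degree (harary k n) ?D = (\<Sum>x\<in>{0..<int n}. ?P x)"
      unfolding degree_harary[symmetric] by simp
    also have "\<dots> = int (2 * sigma k)"
      using sum_packet[of "int n" k 0] n0 by (simp add: sum_distrib_left[symmetric])
    finally have "degree (harary k n) ?D = int (2 * sigma k)" .
    moreover have "positive_rank (harary k n) ?D"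
      using n0 by (intro positive_rank_roll[OF k n'] rank_packet[OF k]) simp
    moreover have "?D \<in> divisors (harary k n)" by (auto simp: divisors_def verts_harary)
    ultimately show "\<exists>D\<in>divisors (harary k n). positive_rank (harary k n) D \<and> degree (harary k n) D = int (2 * sigma k)"
      by blast
  next
    fix d assume "\<exists>D\<in>divisors (harary k n). positive_rank (harary k n) D \<and> degree (harary k n) D = int d"
    then obtain D where D: "positive_rank (harary k n) D" "degree (harary k n) D = int d" by blast
    have "2 * int (sigma k) \<le> (\<Sum>x\<in>{0..<int n}. D (vertex n x))"
      using n by (intro N periodic_vertex positive_rank_unroll[OF k _ D(1)]) auto
    then show "2 * sigma k \<le> d" using D(2) by (simp add: degree_harary[where k = k])
  qed
  then show ?thesis by blast
qed

theorem theorem1p2: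
  fixes k :: nat
  assumes "k \<ge> 1"
  shows "\<exists>N::nat. N \<ge> 2 * k + 1 \<and> (\<forall>n\<ge>N. gonality (harary k n) = gonality (harary k N))"
proof -
  obtain N where "\<And>n. n \<ge> N \<Longrightarrow> gonality (harary k n) = 2 * sigma k"
    using gonality_harary[OF assms] by blast
  then show ?thesis by (intro exI[of _ "max N (2 * k + 1)"]) simp
qed

end
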